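(* For every constant $p\in(0,1)$ there exist constants $c,C>0$ and $H_0\in\mathbb{N}$ (depending only on $p$) such that for every integer $H\ge H_0$ there exist: a layered state space $\mathcal{X}=\bigsqcup_{h=1}^H\mathcal{X}_h$ with $|\mathcal{X}|\le 2^{CH}$; a policy class $\Pi$ of size $|\Pi|=2^H$; a family $\mathcal{M}$ of MDPs with state space $\mathcal{X}$, binary action space $\mathcal{A}=\{0,1\}$ and horizon $H$; and a reset distribution $\mu=\{\mu_h\}_{h=1}^H$, known to the learner; such that every $M\in\mathcal{M}$ satisfies (i) $\Pi$ is realizable for $M$, and (ii) $\mu$ satisfies $C_{\mathsf{all}}(\mu;M)\le 4$; and moreover the following lower bound holds. Any proper deterministic algorithm that interacts through $\mu$-resets and that, for every $M\in\mathcal{M}$, returns with probability at least $p$ a $1/8$-optimal policy for $M$ must sample at least $2^{cH}$ trajectories for some MDP in $\mathcal{M}$.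
   Context: **MDPs.** An episodic finite-horizon MDP is $M=(\mathcal{X},\mathcal{A},H,P,R,d_1)$ with finite layered state space $\mathcal{X}=\bigsqcup_{h=1}^H\mathcal{X}_h$, finite action set $\mathcal{A}$, horizon $H$, transition function $P$ (for $x\in\mathcal{X}_h$ with $h<H$ and $a\in\mathcal{A}$, $P(\cdot\mid x,a)$ is a probability distribution on $\mathcal{X}_{h+1}$), (possibly stochastic) rewards $r_h\sim R(x_h,a_h)$, and initial state distribution $d_1\in\Delta(\mathcal{X}_1)$. The cumulative reward of every trajectory (including trajectories started at a later layer) lies in $[0,1]$. A (Markov) policy is a map $\pi:\mathcal{X}\to\mathcal{A}$, with $\pi_h$ its restriction to $\mathcal{X}_h$. For $x\in\mathcal{X}_h$, $V_h^\pi(x)$ is the expected sum of rewards $r_h+\dots+r_H$ when starting at $x$ in layer $h$ and following $\pi$; $V^\pi=\mathbb{E}_{x\sim d_1}[V_1^\pi(x)]$. The occupancy measure $d_h^\pi\in\Delta(\mathcal{X}_h)$ is the law of the layer-$h$ state when starting from $d_1$ and following $\pi$. **Realizability.** $\Pi$ is realizable for $M$ if it contains an optimal policy $\pi^\star$ of $M$, i.e. some $\pi^\star\in\Pi$ with $V_h^{\pi^\star}(x)=\max_\pi V_h^\pi(x)$ for all $h\in[H]$, $x\in\mathcal{X}_h$ (the maximum being over all policies). A policy $\widehat\pi$ is $\varepsilon$-optimal if $V^{\widehat\pi}\ge\max_{\pi\in\Pi}V^\pi-\varepsilon$. **$\mu$-resets.** A reset distribution is $\mu=\{\mu_h\}_{h=1}^H$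 with $\mu_h\in\Delta(\mathcal{X}_h)$, and it is assumed that $\mu_1=d_1$. In every round of interaction the learner picks a reset layer $h\in[H]$; a state $x_h\sim\mu_h$ is drawn and the learner rolls out a trajectory from $x_h$ to the end of the horizon, choosing the actions $a_h,\dots,a_H$ and observing the states and rewards. Each round counts as one sampled trajectory. The MDP in $\mathcal{M}$ is unknown to the learner; $\mathcal{X},\mathcal{A},H,\Pi,\mathcal{M},\mu$ are known. An algorithm is deterministic if its reset layers, actions, stopping decision and output are deterministic functions of past observations; it is proper if the returned policy belongs to $\Pi$. "Probability" is over the randomness of the interaction with the MDP. **All-policy concentrability.** With $\Pi_{\mathrm{all}}$ the set of all Markov policies on $M$, $$C_{\mathsf{all}}(\mu;M):=\max_{\pi\in\Pi_{\mathrm{all}}}\max_{h\in[H]}\left\|\frac{d_h^\pi}{\mu_h}\right\|_\infty,$$ where $\|\nu/\mu_h\|_\infty$ is the smallest $B\in[0,\infty]$ with $\nu(x)\le B\mu_h(x)$ for all $x\in\mathcal{X}_h$ (convention $1/0=\infty$). *)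

theory Defs
  imports "HOL-Probability.Probability"
begin

section \<open>Layered finite-horizon MDPs\<close>

text \<open>
  Layers are indexed by \<open>1, \<dots>, horizon M\<close>; values of \<open>layer M\<close> at other indices, and of
  \<open>trans M\<close> and \<open>reward M\<close> outside the state and action sets, are irrelevant.
\<close>

record ('s, 'a) mdp =
  layer :: "nat \<Rightarrow> 's set"
  actions :: "'a set"
  horizon :: nat
  trans :: "'s \<Rightarrow> 'a \<Rightarrow> 's pmf"
  reward :: "'s \<Rightarrow> 'a \<Rightarrow> real pmf"
  init :: "'s pmf"

definition layered :: "nat \<Rightarrow> (nat \<Rightarrow> 's set) \<Rightarrow> bool" where
  "layered H X \<longleftrightarrow> (\<forall>h\<in>{1..H}. finite (X h)) \<and> disjoint_family_on X {1..H}"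

definition state_space :: "('s, 'a) mdp \<Rightarrow> 's set" where
  "state_space M = (\<Union>h\<in>{1..horizon M}. layer M h)"

type_synonym ('s, 'a) traj = "('s \<times> 'a \<times> real) list"

definition cum_reward :: "('s, 'a) traj \<Rightarrow> real" where
  "cum_reward \<tau> = (\<Sum>(x, a, r)\<leftarrow>\<tau>. r)"

text \<open>
  \<open>rollout M \<sigma> n \<tau> x\<close> is the law of the trajectory obtained by appending \<open>n\<close> further steps to the
  partial trajectory \<open>\<tau>\<close>, the current state being \<open>x\<close>. The rule \<open>\<sigma>\<close> selects actions from the
  trajectory observed so far and the current state; a Markov policy \<open>\<pi>\<close> is the rule \<open>\<lambda>_. \<pi>\<close>.
  The successor state drawn in the last step is discarded, so the values of \<open>trans M\<close> on
  the last layer play no role.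
\<close>

primrec rollout ::
  "('s, 'a) mdp \<Rightarrow> (('s, 'a) traj \<Rightarrow> 's \<Rightarrow> 'a) \<Rightarrow> nat \<Rightarrow> ('s, 'a) traj \<Rightarrow> 's \<Rightarrow> ('s, 'a) traj pmf"
where
  "rollout M \<sigma> 0 \<tau> x = return_pmf \<tau>"
| "rollout M \<sigma> (Suc n) \<tau> x =
     (let a = \<sigma> \<tau> x in
      bind_pmf (reward M x a) (\<lambda>r.
      bind_pmf (trans M x a) (\<lambda>x'.
      rollout M \<sigma> n (\<tau> @ [(x, a, r)]) x')))"

definition rollout_from ::
  "('s, 'a) mdp \<Rightarrow> (('s, 'a) traj \<Rightarrow> 's \<Rightarrow> 'a) \<Rightarrow> nat \<Rightarrow> 's \<Rightarrow> ('s, 'a) traj pmf"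
where
  "rollout_from M \<sigma> h x = rollout M \<sigma> (Suc (horizon M) - h) [] x"

text \<open>
  The last conjunct says that every trajectory that can occur, from any layer and under any
  choice of actions, has cumulative reward in \<open>[0,1]\<close>.
\<close>

definition is_mdp :: "('s, 'a) mdp \<Rightarrow> bool" where
  "is_mdp M \<longleftrightarrow>
     1 \<le> horizon M \<and>
     layered (horizon M) (layer M) \<and>
     finite (actions M) \<and> actions M \<noteq> {} \<and>
     set_pmf (init M) \<subseteq> layer M 1 \<and>
     (\<forall>h. 1 \<le> h \<and> h < horizon M \<longrightarrow>
        (\<forall>x\<in>layer M h. \<forall>a\<in>actions M. set_pmf (trans M x a) \<subseteq> layer M (Suc h))) \<and>
     (\<forall>h\<in>{1..horizon M}. \<forall>x\<in>layer M h. \<forall>\<sigma>. (\<forall>\<tau> y. \<sigma> \<tau> y \<in> actions M) \<longrightarrow>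
        (\<forall>\<tau>\<in>set_pmf (rollout_from M \<sigma> h x). cum_reward \<tau> \<in> {0..1}))"


section \<open>Policies, values and occupancy measures\<close>

text \<open>
  Policies are extensional functions on the state space, so that distinct elements of a
  policy class are distinct as maps from states to actions.
\<close>

definition policies :: "('s, 'a) mdp \<Rightarrow> ('s \<Rightarrow> 'a) set" where
  "policies M = (state_space M \<rightarrow>\<^sub>E actions M)"

definition state_value :: "('s, 'a) mdp \<Rightarrow> ('s \<Rightarrow> 'a) \<Rightarrow> nat \<Rightarrow> 's \<Rightarrow> real" where
  "state_value M \<pi> h x = measure_pmf.expectation (rollout_from M (\<lambda>_. \<pi>) h x) cum_reward"

definition policy_value :: "('s, 'a) mdp \<Rightarrow> ('s \<Rightarrow> 'a) \<Rightarrow> real" where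
  "policy_value M \<pi> = measure_pmf.expectation (init M) (state_value M \<pi> 1)"

definition occupancy :: "('s, 'a) mdp \<Rightarrow> ('s \<Rightarrow> 'a) \<Rightarrow> nat \<Rightarrow> 's pmf" where
  "occupancy M \<pi> h =
     map_pmf (\<lambda>\<tau>. fst (\<tau> ! (h - 1))) (bind_pmf (init M) (rollout_from M (\<lambda>_. \<pi>) 1))"

definition realizable :: "('s \<Rightarrow> 'a) set \<Rightarrow> ('s, 'a) mdp \<Rightarrow> bool" where
  "realizable Pol M \<longleftrightarrow>
     (\<exists>\<pi>'\<in>Pol. \<forall>h\<in>{1..horizon M}. \<forall>x\<in>layer M h.
        state_value M \<pi>' h x = Max ((\<lambda>\<pi>. state_value M \<pi> h x) ` policies M))"

definition eps_optimal :: "('s \<Rightarrow> 'a) set \<Rightarrow> ('s, 'a) mdp \<Rightarrow> real \<Rightarrow> ('s \<Rightarrow> 'a) \<Rightarrow> bool" where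
  "eps_optimal Pol M \<epsilon> \<pi> \<longleftrightarrow> policy_value M \<pi> \<ge> Max (policy_value M ` Pol) - \<epsilon>"


section \<open>Reset distributions and concentrability\<close>

definition is_reset :: "(nat \<Rightarrow> 's pmf) \<Rightarrow> ('s, 'a) mdp \<Rightarrow> bool" where
  "is_reset \<mu> M \<longleftrightarrow> (\<forall>h\<in>{1..horizon M}. set_pmf (\<mu> h) \<subseteq> layer M h) \<and> \<mu> 1 = init M"

text \<open>The infimum is \<open>\<infinity>\<close> if \<open>\<nu>\<close> charges a point of \<open>X\<close> that \<open>\<mu>\<close> does not.\<close>

definition ratio_norm :: "'s set \<Rightarrow> 's pmf \<Rightarrow> 's pmf \<Rightarrow> ennreal" where
  "ratio_norm X \<nu> \<mu> = Inf {B. \<forall>x\<in>X. ennreal (pmf \<nu> x) \<le> B * ennreal (pmf \<mu> x)}"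

definition C_all :: "(nat \<Rightarrow> 's pmf) \<Rightarrow> ('s, 'a) mdp \<Rightarrow> ennreal" where
  "C_all \<mu> M =
     (SUP \<pi>\<in>policies M. SUP h\<in>{1..horizon M}. ratio_norm (layer M h) (occupancy M \<pi> h) (\<mu> h))"


section \<open>Deterministic algorithms with reset access\<close>

text \<open>
  A history lists the completed rounds, each with its reset layer and observed trajectory.
  At the start of a round the algorithm either resets to a layer or stops and returns a
  policy; within a round it chooses actions from the history, the trajectory observed so far
  in this round and the current state.
\<close>

type_synonym ('s, 'a) history = "(nat \<times> ('s, 'a) traj) list"

datatype ('s, 'a) decision = Reset nat | Return "'s \<Rightarrow> 'a"

record ('s, 'a) algorithm =
  decide :: "('s, 'a) history \<Rightarrow> ('s, 'a) decision"
  act :: "('s, 'a) history \<Rightarrow> ('s, 'a) traj \<Rightarrow> 's \<Rightarrow> 'a"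

definition proper_algorithm ::
  "nat \<Rightarrow> 'a set \<Rightarrow> ('s \<Rightarrow> 'a) set \<Rightarrow> ('s, 'a) algorithm \<Rightarrow> bool"
where
  "proper_algorithm H A Pol alg \<longleftrightarrow>
     (\<forall>hist. case decide alg hist of Reset h \<Rightarrow> h \<in> {1..H} | Return \<pi> \<Rightarrow> \<pi> \<in> Pol) \<and>
     (\<forall>hist \<tau> x. act alg hist \<tau> x \<in> A)"

text \<open>
  \<open>play M \<mu> alg k\<close> is the law of the history after at most \<open>k\<close> rounds; once the
  algorithm has stopped, the history no longer changes.
\<close>

primrec play ::
  "('s, 'a) mdp \<Rightarrow> (nat \<Rightarrow> 's pmf) \<Rightarrow> ('s, 'a) algorithm \<Rightarrow> nat \<Rightarrow> ('s, 'a) history pmf"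
where
  "play M \<mu> alg 0 = return_pmf []"
| "play M \<mu> alg (Suc k) =
     bind_pmf (play M \<mu> alg k) (\<lambda>hist.
       case decide alg hist of
         Return \<pi> \<Rightarrow> return_pmf hist
       | Reset h \<Rightarrow>
           map_pmf (\<lambda>\<tau>. hist @ [(h, \<tau>)])
             (bind_pmf (\<mu> h) (rollout_from M (act alg hist) h)))"

text \<open>
  Both events below persist once they hold at some round, so their probabilities
  under \<open>play M \<mu> alg k\<close> increase with \<open>k\<close>, and the supremum is the probability in the
  full, possibly non-terminating interaction. An interaction that never stops returns no policy
  and samples more than any finite number of trajectories.
\<close>

definition prob_returns ::
  "('s, 'a) mdp \<Rightarrow> (nat \<Rightarrow> 's pmf) \<Rightarrow> ('s, 'a) algorithm \<Rightarrow> (('s \<Rightarrow> 'a) \<Rightarrow> bool) \<Rightarrow> real"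
where
  "prob_returns M \<mu> alg Q =
     (SUP k. measure_pmf.prob (play M \<mu> alg k) {hist. \<exists>\<pi>. decide alg hist = Return \<pi> \<and> Q \<pi>})"

definition prob_samples_at_least ::
  "('s, 'a) mdp \<Rightarrow> (nat \<Rightarrow> 's pmf) \<Rightarrow> ('s, 'a) algorithm \<Rightarrow> real \<Rightarrow> real"
where
  "prob_samples_at_least M \<mu> alg T =
     (SUP k. measure_pmf.prob (play M \<mu> alg k) {hist. T \<le> real (length hist)})"

end

theory Submission
  imports Defs "HOL-Real_Asymp.Real_Asymp"
begin

text \<open>
  Every layer carries exponentially many observations \<open>(j, s)\<close>, and a hidden shift \<open>\<omega> (h, j)\<close> of
  \<open>s\<close> assigns to each of them one of four latent classes. In the first \<open>K = H div 2\<close> layers,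
  Good stays Good while the action agrees with the secret bit \<open>\<theta>\<close> of the layer and pays 1 at
  layer \<open>K\<close>; any disagreement leads to Dead, which pays 0. Junk does the opposite: a disagreement
  leads to Free, which pays 1 at layer \<open>K\<close>, and permanent agreement leads to a combination
  lock in the layers after \<open>K\<close>, which pays 1 at layer \<open>H\<close> and keeps \<open>\<theta>\<close> optimal. Good and
  Junk are equally likely under a reset, so a rollout started in one of the layers \<open>2, \<dots>, K\<close> earns
  1 with probability 1/2 whatever \<open>\<theta>\<close> is, unless the lock is opened. Junk and Free are not
  reachable from the initial distribution, and Good and Dead fill a quarter of their layers, which
  gives concentrability 4.

  Averaged over \<open>\<omega>\<close>, the law of a history dominates \<open>(1 - 1/S)^k\<close> times its law in an ideal process
  independent of \<open>\<theta>\<close>, as long as no block \<open>(h, j)\<close> is seen in two rounds and no action sequence of the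
  history contains one of the two halves of \<open>\<theta>\<close>. All exceptions are exponentially rare, so for most
  \<open>\<theta>\<close> the returned policy differs from \<open>\<theta>\<close> in the first half, and then its value is 0.
\<close>

section \<open>Encoding of states and cyclic shifts\<close>

datatype cls = Good | Junk | Free | Dead

text \<open>States have to be natural numbers. Packing the layer into the number makes the layers
  disjoint.\<close>

definition enc :: "nat \<Rightarrow> nat \<Rightarrow> nat \<Rightarrow> nat" where
  "enc h j s = prod_encode (h, prod_encode (j, s))"

definition lay :: "nat \<Rightarrow> nat" where "lay x = fst (prod_decode x)"

definition blk :: "nat \<Rightarrow> nat \<times> nat" where
  "blk x = (lay x, fst (prod_decode (snd (prod_decode x))))"

definition pos :: "nat \<Rightarrow> nat" where "pos x = snd (prod_decode (snd (prod_decode x)))"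

lemma enc_simps [simp]: "lay (enc h j s) = h" "blk (enc h j s) = (h, j)" "pos (enc h j s) = s"
  by (simp_all add: enc_def lay_def blk_def pos_def)

lemma fst_blk [simp]: "fst (blk x) = lay x"
  by (simp add: blk_def)

lemma enc_decode: "enc (lay x) (snd (blk x)) (pos x) = x"
  by (simp add: enc_def lay_def blk_def pos_def)

text \<open>A secret bit string is kept as the set of layers with bit 1, so the secrets are
  \<open>Pow {1..H}\<close>.\<close>

definition bit_at :: "nat set \<Rightarrow> nat \<Rightarrow> nat" where "bit_at \<theta> h = of_bool (h \<in> \<theta>)"

lemma bij_betw_shift_mod:
  fixes S w :: nat
  shows "bij_betw (\<lambda>s. (s + w) mod S) {..<S} {..<S}"
proof -
  have "inj_on (\<lambda>s. (s + w) mod S) {..<S}"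
  proof (rule inj_onI)
    fix s t assume st: "s \<in> {..<S}" "t \<in> {..<S}" and eq: "(s + w) mod S = (t + w) mod S"
    \<comment> \<open>The shift is cancelled over the integers, where subtraction is not
      truncated.\<close>
    have "(int s + int w) mod int S = (int t + int w) mod int S"
      using eq by (metis of_nat_add of_nat_mod)
    then have "(int s + int w - int w) mod int S = (int t + int w - int w) mod int S"
      by (rule mod_diff_cong) simp
    then have "s mod S = t mod S"
      by (simp flip: of_nat_mod)
    then show "s = t" using st by simp
  qed
  moreover have "(\<lambda>s. (s + w) mod S) ` {..<S} \<subseteq> {..<S}"
    by (auto intro: mod_less_divisor)
  ultimately show ?thesis
    by (simp add: bij_betw_def endo_inj_surj)
qed

text \<open>Serves in both directions: for a fixed shift it counts the positions of a class, for a
  fixed position the shifts that give it a class.\<close>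

lemma card_shift_mod:
  fixes S w :: nat
  shows "card {s \<in> {..<S}. P ((s + w) mod S)} = card {v \<in> {..<S}. P v}"
proof -
  have "bij_betw (\<lambda>s. (s + w) mod S) {s \<in> {..<S}. P ((s + w) mod S)} {v \<in> {..<S}. P v}"
  proof -
    have b: "bij_betw (\<lambda>s. (s + w) mod S) {..<S} {..<S}" by (rule bij_betw_shift_mod)
    have "(\<lambda>s. (s + w) mod S) ` {s \<in> {..<S}. P ((s + w) mod S)} = {v \<in> {..<S}. P v}"
    proof safe
      fix v assume "v < S" "P v"
      then obtain s where "s < S" "(s + w) mod S = v"
        using b by (metis (no_types, lifting) bij_betw_def imageE lessThan_iff)
      then show "v \<in> (\<lambda>s. (s + w) mod S) ` {s \<in> {..<S}. P ((s + w) mod S)}"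
        using \<open>P v\<close> by auto
    qed auto
    then show ?thesis
      using b unfolding bij_betw_def by (auto intro: inj_on_subset)
  qed
  then show ?thesis by (rule bij_betw_same_card)
qed

lemma expectation_pmf_const:
  assumes "\<And>x. x \<in> set_pmf p \<Longrightarrow> f x = (v::real)"
  shows "measure_pmf.expectation p f = v"
proof -
  have "measure_pmf.expectation p f = measure_pmf.expectation p (\<lambda>_. v)"
    using assms by (intro integral_cong_AE) (auto simp: AE_measure_pmf_iff)
  then show ?thesis by simp
qed

lemma pmf_bind_le_const:
  assumes "\<And>x. x \<in> set_pmf p \<Longrightarrow> pmf (f x) y \<le> B"
  shows "pmf (bind_pmf p f) y \<le> B"
proof -
  have "pmf (bind_pmf p f) y = measure_pmf.expectation p (\<lambda>x. pmf (f x) y)"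
    by (rule pmf_bind)
  also have "\<dots> \<le> measure_pmf.expectation p (\<lambda>_. B)"
  proof (rule integral_mono_AE)
    show "integrable p (\<lambda>x. pmf (f x) y)"
      by (rule measure_pmf.integrable_const_bound[where B=1]) (auto simp: pmf_le_1)
  qed (use assms in \<open>auto simp: AE_measure_pmf_iff\<close>)
  finally show ?thesis by simp
qed

section \<open>The MDP family and its class sizes\<close>

locale hard_family =
  fixes H K m n :: nat
  assumes K_ge: "2 \<le> K" and K_less: "K < H" and m_pos: "0 < m" and n_pos: "0 < n"
begin

text \<open>A block has four groups of \<open>m\<close> positions, one for each class in the layers
  \<open>2, ..., K\<close>.\<close>

definition S :: nat where "S = 4 * m"

text \<open>Layer 1 is entirely Good because \<open>\<mu> 1\<close> has to be the initial
  distribution. After layer \<open>K\<close> a single position of each block belongs to the lock, so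
  a uniform reset there meets it only with probability \<open>1 / S\<close>.\<close>

definition cl :: "nat \<Rightarrow> nat \<Rightarrow> cls" where
  "cl h v =
     (if h \<le> 1 then Good
      else if h \<le> K then
        (if v < m then Good else if v < 2 * m then Junk else if v < 3 * m then Free else Dead)
      else if v = 0 then Junk else Dead)"

definition X :: "nat \<Rightarrow> nat set" where
  "X h = (\<lambda>(j, s). enc h j s) ` ({..<n} \<times> {..<S})"

text \<open>
  For fixed \<open>j\<close> the shift permutes the values of \<open>s\<close>, so the class sizes of a layer do not depend
  on \<open>\<omega>\<close>. After layer \<open>K\<close> the class Junk is the combination lock.
\<close>

definition clss :: "(nat \<times> nat \<Rightarrow> nat) \<Rightarrow> nat \<Rightarrow> cls" where
  "clss \<omega> x = cl (lay x) ((pos x + \<omega> (blk x)) mod S)"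

definition cell :: "(nat \<times> nat \<Rightarrow> nat) \<Rightarrow> nat \<Rightarrow> cls \<Rightarrow> nat set" where
  "cell \<omega> h c = {x \<in> X h. clss \<omega> x = c}"

definition frac :: "nat \<Rightarrow> cls \<Rightarrow> real" where
  "frac h c = real (card {v \<in> {..<S}. cl h v = c}) / real S"

text \<open>The classes that occupy at least one position of a block in layer \<open>h\<close>; only
  their cells carry a uniform distribution.\<close>

definition valid :: "nat \<Rightarrow> cls \<Rightarrow> bool" where
  "valid h c \<longleftrightarrow> (if h \<le> 1 then c = Good else if h \<le> K then True else c \<in> {Junk, Dead})"

fun nxt :: "nat set \<Rightarrow> nat \<Rightarrow> cls \<Rightarrow> nat \<Rightarrow> cls" where
  "nxt \<theta> h Good a = (if h < K \<and> a = bit_at \<theta> h then Good else Dead)"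
| "nxt \<theta> h Junk a = (if a = bit_at \<theta> h then if h < H then Junk else Dead else if h < K then Free else Dead)"
| "nxt \<theta> h Free a = (if h < K then Free else Dead)"
| "nxt \<theta> h Dead a = Dead"

text \<open>Wherever \<open>rew\<close> is 1, \<open>nxt\<close> leads to Dead; hence a trajectory
  is paid at most once.\<close>

fun rew :: "nat set \<Rightarrow> nat \<Rightarrow> cls \<Rightarrow> nat \<Rightarrow> real" where
  "rew \<theta> h Good a = of_bool (h = K \<and> a = bit_at \<theta> h)"
| "rew \<theta> h Junk a = of_bool (h = K \<and> a \<noteq> bit_at \<theta> h \<or> h = H \<and> a = bit_at \<theta> h)"
| "rew \<theta> h Free a = of_bool (h = K)"
| "rew \<theta> h Dead a = 0"

text \<open>Successors are uniform on the cell of the next class, so the learner sees a block and a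
  position, while the class is hidden behind the shift of the block.\<close>

definition mdp_of :: "nat set \<Rightarrow> (nat \<times> nat \<Rightarrow> nat) \<Rightarrow> (nat, nat) mdp" where
  "mdp_of \<theta> \<omega> =
     \<lparr>layer = X, actions = {0, 1}, horizon = H,
      trans = \<lambda>x a. pmf_of_set (cell \<omega> (Suc (lay x)) (nxt \<theta> (lay x) (clss \<omega> x) a)),
      reward = \<lambda>x a. return_pmf (rew \<theta> (lay x) (clss \<omega> x) a),
      init = pmf_of_set (X 1)\<rparr>"

definition pol :: "nat set \<Rightarrow> nat \<Rightarrow> nat" where
  "pol \<theta> = (\<lambda>x\<in>(\<Union>h\<in>{1..H}. X h). bit_at \<theta> (lay x))"

lemma S_pos: "0 < S" and S_ge: "4 \<le> S"
  using m_pos by (auto simp: S_def)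

lemma lay_X [simp]: "x \<in> X h \<Longrightarrow> lay x = h"
  by (auto simp: X_def)

lemma snd_blk_X: "x \<in> X h \<Longrightarrow> snd (blk x) < n"
  by (auto simp: X_def)

lemma pos_X: "x \<in> X h \<Longrightarrow> pos x < S"
  by (auto simp: X_def)

lemma finite_X [simp]: "finite (X h)"
  by (simp add: X_def)

lemma inj_enc: "inj_on (\<lambda>(j, s). enc h j s) A"
  by (auto simp: inj_on_def enc_def)

lemma card_X: "card (X h) = n * S"
  by (simp add: X_def card_image inj_enc)

lemma X_nonempty [simp]: "X h \<noteq> {}"
  using card_X[of h] n_pos S_pos by auto

lemma clss_X: "x \<in> X h \<Longrightarrow> clss \<omega> x = cl h ((pos x + \<omega> (blk x)) mod S)"
  by (simp add: clss_def)

lemma valid_clss: "x \<in> X h \<Longrightarrow> valid h (clss \<omega> x)"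
  by (auto simp: clss_X valid_def cl_def)

text \<open>Good and Free have to end at layer \<open>K\<close>, since only Junk and Dead have
  positions after it. By \<open>K_ge\<close> the successors of layer 1 lie in a layer that has all
  four classes.\<close>

lemma valid_nxt: "1 \<le> h \<Longrightarrow> valid h c \<Longrightarrow> valid (Suc h) (nxt \<theta> h c a)"
  using K_ge by (cases c) (auto simp: valid_def split: if_splits)

lemma card_cell: "card (cell \<omega> h c) = n * card {v \<in> {..<S}. cl h v = c}"
proof -
  have "cell \<omega> h c =
    (\<lambda>(j, s). enc h j s) ` (SIGMA j:{..<n}. {s \<in> {..<S}. cl h ((s + \<omega> (h, j)) mod S) = c})"
    unfolding cell_def X_def by (force simp: clss_def)
  then have "card (cell \<omega> h c) =
    card (SIGMA j:{..<n}. {s \<in> {..<S}. cl h ((s + \<omega> (h, j)) mod S) = c})"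
    by (simp add: card_image inj_enc)
  also have "\<dots> = (\<Sum>j<n. card {s \<in> {..<S}. cl h ((s + \<omega> (h, j)) mod S) = c})"
    by simp
  also have "\<dots> = n * card {v \<in> {..<S}. cl h v = c}"
    by (simp only: card_shift_mod[where P = "\<lambda>v. cl h v = c"]) simp
  finally show ?thesis .
qed

lemma finite_cell [simp]: "finite (cell \<omega> h c)"
  by (simp add: cell_def)

lemma real_card_cell: "real (card (cell \<omega> h c)) = real (n * S) * frac h c"
  using S_pos by (simp add: card_cell frac_def)

lemma frac_first: "h \<le> 1 \<Longrightarrow> frac h Good = 1"
  using S_pos by (simp add: frac_def cl_def)

lemma frac_mid:
  assumes "1 < h" "h \<le> K"
  shows "frac h c = 1 / 4"
proof -
  have "{v \<in> {..<S}. cl h v = Good} = {..<m}" "{v \<in> {..<S}. cl h v = Junk} = {m..<2*m}"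
    "{v \<in> {..<S}. cl h v = Free} = {2*m..<3*m}" "{v \<in> {..<S}. cl h v = Dead} = {3*m..<4*m}"
    using assms by (auto simp: cl_def S_def split: if_splits)
  then have "card {v \<in> {..<S}. cl h v = c} = m"
    by (cases c) auto
  then show ?thesis using m_pos by (simp add: frac_def S_def)
qed

lemma frac_late_Dead: "K < h \<Longrightarrow> frac h Dead = 1 - 1 / real S"
proof -
  assume "K < h"
  then have "{v \<in> {..<S}. cl h v = Dead} = {..<S} - {0}"
    using K_ge by (auto simp: cl_def split: if_splits)
  then have "card {v \<in> {..<S}. cl h v = Dead} = S - 1"
    using S_pos by simp
  then show ?thesis using S_pos by (simp add: frac_def diff_divide_distrib of_nat_diff)
qed

lemma frac_late_Junk: "K < h \<Longrightarrow> frac h Junk = 1 / real S"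
proof -
  assume "K < h"
  then have "{v \<in> {..<S}. cl h v = Junk} = {0}"
    using K_ge S_pos by (auto simp: cl_def split: if_splits)
  then show ?thesis by (simp add: frac_def)
qed

lemma frac_pos: "valid h c \<Longrightarrow> 0 < frac h c"
  using S_ge frac_first frac_mid frac_late_Dead frac_late_Junk
  by (cases c) (auto simp: valid_def not_le frac_first frac_mid frac_late_Dead frac_late_Junk split: if_splits)

text \<open>Source of the constant 4: only Good and Dead are reached from the initial distribution,
  and each fills a quarter of the layers up to \<open>K\<close> or more than that elsewhere.\<close>

lemma frac_reachable: "valid h c \<Longrightarrow> c = Good \<or> c = Dead \<Longrightarrow> 1 / 4 \<le> frac h c"
  using S_ge
  by (auto simp: valid_def not_le frac_first frac_mid frac_late_Dead field_simps split: if_splits)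

lemma cell_nonempty: "valid h c \<Longrightarrow> cell \<omega> h c \<noteq> {}"
  using real_card_cell[of \<omega> h c] frac_pos[of h c] n_pos S_pos by auto

lemma cell_first: "cell \<omega> (Suc 0) Good = X (Suc 0)"
  by (auto simp: cell_def clss_X cl_def)

section \<open>Cumulative rewards and the MDP axioms\<close>

lemma set_rollout_mdp_Suc:
  assumes "x \<in> X h" "1 \<le> h" "\<tau> \<in> set_pmf (rollout (mdp_of \<theta> \<omega>) \<sigma> (Suc k) \<tau>0 x)"
  obtains y where "y \<in> X (Suc h)" "clss \<omega> y = nxt \<theta> h (clss \<omega> x) (\<sigma> \<tau>0 x)"
    "\<tau> \<in> set_pmf (rollout (mdp_of \<theta> \<omega>) \<sigma> k
        (\<tau>0 @ [(x, \<sigma> \<tau>0 x, rew \<theta> h (clss \<omega> x) (\<sigma> \<tau>0 x))]) y)"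
proof -
  let ?c = "nxt \<theta> h (clss \<omega> x) (\<sigma> \<tau>0 x)"
  \<comment> \<open>The support of \<open>pmf_of_set\<close> is known for nonempty sets
    only.\<close>
  have "cell \<omega> (Suc h) ?c \<noteq> {}"
    using assms by (intro cell_nonempty valid_nxt valid_clss)
  then have "set_pmf (pmf_of_set (cell \<omega> (Suc h) ?c)) = cell \<omega> (Suc h) ?c"
    by simp
  then show ?thesis
    using assms(1,3) by (auto simp: Let_def mdp_of_def bind_return_pmf cell_def intro: that)
qed

lemma cum_reward_snoc [simp]: "cum_reward (\<tau> @ [(x, a, r)]) = cum_reward \<tau> + r"
  by (simp add: cum_reward_def)

lemma rollout_Dead:
  assumes "x \<in> X h" "1 \<le> h" "clss \<omega> x = Dead"
    "\<tau> \<in> set_pmf (rollout (mdp_of \<theta> \<omega>) \<sigma> k \<tau>0 x)"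
  shows "cum_reward \<tau> = cum_reward \<tau>0"
  using assms
proof (induction k arbitrary: x h \<tau>0)
  case (Suc k)
  obtain y where "y \<in> X (Suc h)" "clss \<omega> y = Dead"
    "\<tau> \<in> set_pmf (rollout (mdp_of \<theta> \<omega>) \<sigma> k (\<tau>0 @ [(x, \<sigma> \<tau>0 x, 0)]) y)"
    using set_rollout_mdp_Suc[OF Suc.prems(1,2,4)] Suc.prems(3) by auto
  from Suc.IH[OF this(1) _ this(2,3)] show ?case by simp
qed simp

text \<open>Each reward is 0 or 1, and after a 1 the state is Dead, where
  \<open>rollout_Dead\<close> excludes further reward. Subtracting the reward of the prefix keeps
  the claim inductive.\<close>

lemma rollout_cum_reward_bounds:
  assumes "x \<in> X h" "1 \<le> h" "\<tau> \<in> set_pmf (rollout (mdp_of \<theta> \<omega>) \<sigma> k \<tau>0 x)"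
  shows "cum_reward \<tau> - cum_reward \<tau>0 \<in> {0..1}"
  using assms
proof (induction k arbitrary: x h \<tau>0)
  case (Suc k)
  let ?a = "\<sigma> \<tau>0 x"
  obtain y where y: "y \<in> X (Suc h)" "clss \<omega> y = nxt \<theta> h (clss \<omega> x) ?a"
    "\<tau> \<in> set_pmf (rollout (mdp_of \<theta> \<omega>) \<sigma> k (\<tau>0 @ [(x, ?a, rew \<theta> h (clss \<omega> x) ?a)]) y)"
    using set_rollout_mdp_Suc[OF Suc.prems] by blast
  show ?case
  proof (cases "rew \<theta> h (clss \<omega> x) ?a = 0")
    case True
    then show ?thesis using Suc.IH[OF y(1) _ y(3)] by simp
  next
    case False
    then have "clss \<omega> y = Dead" "rew \<theta> h (clss \<omega> x) ?a = 1"
      using y(2) K_less by (cases "clss \<omega> x"; auto split: if_splits)+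
    then show ?thesis using rollout_Dead[OF y(1) _ _ y(3)] by simp
  qed
qed simp

lemma mdp_of_simps [simp]:
  "layer (mdp_of \<theta> \<omega>) = X" "actions (mdp_of \<theta> \<omega>) = {0, 1}" "horizon (mdp_of \<theta> \<omega>) = H"
  "init (mdp_of \<theta> \<omega>) = pmf_of_set (X 1)"
  by (simp_all add: mdp_of_def)

lemma layered_X: "layered H X"
  by (auto simp: layered_def disjoint_family_on_def dest!: lay_X)

lemma is_mdp_mdp_of: "is_mdp (mdp_of \<theta> \<omega>)"
  unfolding is_mdp_def
proof (intro conjI allI ballI impI)
  fix h x a assume "1 \<le> h \<and> h < horizon (mdp_of \<theta> \<omega>)" "x \<in> layer (mdp_of \<theta> \<omega>) h"
  then have "cell \<omega> (Suc h) (nxt \<theta> h (clss \<omega> x) a) \<noteq> {}"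
    by (intro cell_nonempty valid_nxt valid_clss) auto
  with \<open>x \<in> layer (mdp_of \<theta> \<omega>) h\<close>
  show "set_pmf (trans (mdp_of \<theta> \<omega>) x a) \<subseteq> layer (mdp_of \<theta> \<omega>) (Suc h)"
    by (auto simp: mdp_of_def cell_def)
next
  fix h x \<sigma> \<tau>
  assume "h \<in> {1..horizon (mdp_of \<theta> \<omega>)}" "x \<in> layer (mdp_of \<theta> \<omega>) h"
    "\<tau> \<in> set_pmf (rollout_from (mdp_of \<theta> \<omega>) \<sigma> h x)"
  then show "cum_reward \<tau> \<in> {0..1}"
    using rollout_cum_reward_bounds[of x h \<tau> \<theta> \<omega> \<sigma> "Suc H - h" "[]"]
    by (auto simp: rollout_from_def cum_reward_def)
qed (use K_ge K_less layered_X in auto)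

section \<open>Values, realizability and near-optimal policies\<close>

lemma pol_X: "x \<in> X h \<Longrightarrow> 1 \<le> h \<Longrightarrow> h \<le> H \<Longrightarrow> pol \<theta> x = bit_at \<theta> h"
  by (auto simp: pol_def)

text \<open>Under agreement Good and Free are paid at layer \<open>K\<close> and Junk at the end of
  the lock. Without the lock, agreement would earn nothing from Junk, and
  \<open>pol \<theta>\<close> would fail to be optimal there.\<close>

lemma rollout_pol:
  assumes "x \<in> X h" "1 \<le> h" "h \<le> H" "h + k = Suc H" "clss \<omega> x \<noteq> Dead"
    "\<tau> \<in> set_pmf (rollout (mdp_of \<theta> \<omega>) (\<lambda>_. pol \<theta>) k \<tau>0 x)"
  shows "cum_reward \<tau> = cum_reward \<tau>0 + 1"
  using assms
proof (induction k arbitrary: x h \<tau>0)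
  case (Suc k)
  let ?a = "pol \<theta> x" and ?r = "rew \<theta> h (clss \<omega> x) (pol \<theta> x)"
  obtain y where y: "y \<in> X (Suc h)" "clss \<omega> y = nxt \<theta> h (clss \<omega> x) ?a"
    "\<tau> \<in> set_pmf (rollout (mdp_of \<theta> \<omega>) (\<lambda>_. pol \<theta>) k (\<tau>0 @ [(x, ?a, ?r)]) y)"
    using set_rollout_mdp_Suc[OF Suc.prems(1,2,6)] by blast
  have a: "?a = bit_at \<theta> h" using Suc.prems by (simp add: pol_X)
  \<comment> \<open>Either the reward comes now, or the state stays alive in a layer before
    \<open>H\<close>: a living state of layer \<open>H\<close> is Junk, which agreement pays at
    once.\<close>
  have "?r = 1 \<and> clss \<omega> y = Dead \<or> ?r = 0 \<and> clss \<omega> y \<noteq> Dead \<and> h < H"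
    using valid_clss[OF Suc.prems(1), of \<omega>] Suc.prems(2,3,5) K_ge K_less unfolding y(2) a
    by (cases "clss \<omega> x") (auto simp: valid_def split: if_splits)
  then show ?case
  proof
    assume "?r = 1 \<and> clss \<omega> y = Dead"
    then show ?thesis using rollout_Dead[OF y(1) _ _ y(3)] by simp
  next
    assume "?r = 0 \<and> clss \<omega> y \<noteq> Dead \<and> h < H"
    then show ?thesis using Suc.IH[OF y(1) _ _ _ _ y(3)] Suc.prems(4) by simp
  qed
qed simp

text \<open>Good is paid only at layer \<open>K\<close> and only for agreement; the first mismatch,
  at \<open>K\<close> or earlier, forfeits this and leads to Dead.\<close>

lemma rollout_pol_mismatch:
  assumes "x \<in> X h" "1 \<le> h" "h \<le> K" "clss \<omega> x = Good"
    "\<exists>i\<in>{h..K}. (i \<in> \<theta>) \<noteq> (i \<in> \<theta>')"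
    "\<tau> \<in> set_pmf (rollout (mdp_of \<theta> \<omega>) (\<lambda>_. pol \<theta>') k \<tau>0 x)"
  shows "cum_reward \<tau> = cum_reward \<tau>0"
  using assms
proof (induction k arbitrary: x h \<tau>0)
  case (Suc k)
  let ?a = "pol \<theta>' x" and ?r = "rew \<theta> h (clss \<omega> x) (pol \<theta>' x)"
  obtain y where y: "y \<in> X (Suc h)" "clss \<omega> y = nxt \<theta> h (clss \<omega> x) ?a"
    "\<tau> \<in> set_pmf (rollout (mdp_of \<theta> \<omega>) (\<lambda>_. pol \<theta>') k (\<tau>0 @ [(x, ?a, ?r)]) y)"
    using set_rollout_mdp_Suc[OF Suc.prems(1,2,6)] by blast
  have a: "?a = bit_at \<theta>' h" using Suc.prems K_less by (simp add: pol_X)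
  show ?case
  proof (cases "(h \<in> \<theta>) = (h \<in> \<theta>')")
    case True
    then obtain i where i: "i \<in> {Suc h..K}" "(i \<in> \<theta>) \<noteq> (i \<in> \<theta>')"
      using Suc.prems(5) by (metis atLeastAtMost_iff not_less_eq_eq le_antisym)
    then have "?r = 0" "clss \<omega> y = Good"
      using a True y(2) Suc.prems(4) by (auto simp: bit_at_def)
    then show ?thesis using Suc.IH[OF y(1) _ _ _ bexI[OF _ i(1)] y(3)] i by simp
  next
    case False
    then have "?r = 0" "clss \<omega> y = Dead"
      using a y(2) Suc.prems(4) by (auto simp: bit_at_def)
    then show ?thesis using rollout_Dead[OF y(1) _ _ y(3)] by simp
  qed
qed simp

lemma cum_reward_Nil [simp]: "cum_reward [] = 0"
  by (simp add: cum_reward_def)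

lemma state_value_pol:
  assumes "x \<in> X h" "1 \<le> h" "h \<le> H"
  shows "state_value (mdp_of \<theta> \<omega>) (pol \<theta>) h x = of_bool (clss \<omega> x \<noteq> Dead)"
  unfolding state_value_def
proof (rule expectation_pmf_const)
  fix \<tau> assume "\<tau> \<in> set_pmf (rollout_from (mdp_of \<theta> \<omega>) (\<lambda>_. pol \<theta>) h x)"
  then have \<tau>: "\<tau> \<in> set_pmf (rollout (mdp_of \<theta> \<omega>) (\<lambda>_. pol \<theta>) (Suc H - h) [] x)"
    by (simp add: rollout_from_def)
  show "cum_reward \<tau> = of_bool (clss \<omega> x \<noteq> Dead)"
  proof (cases "clss \<omega> x = Dead")
    case True
    then show ?thesis using rollout_Dead[OF assms(1,2) True \<tau>] by simp
  next
    case False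
    then show ?thesis using rollout_pol[OF assms _ False \<tau>] assms(3) by simp
  qed
qed

text \<open>By \<open>state_value_pol\<close> the bound is attained by \<open>pol \<theta>\<close>,
  which is therefore optimal in every state, including those that are unreachable from the initial
  distribution.\<close>

lemma state_value_le:
  assumes "x \<in> X h" "1 \<le> h" "h \<le> H"
  shows "state_value (mdp_of \<theta> \<omega>) \<pi> h x \<le> of_bool (clss \<omega> x \<noteq> Dead)"
proof -
  have *: "0 \<le> cum_reward \<tau> \<and> cum_reward \<tau> \<le> 1 \<and> cum_reward \<tau> \<le> of_bool (clss \<omega> x \<noteq> Dead)"
    if "\<tau> \<in> set_pmf (rollout_from (mdp_of \<theta> \<omega>) (\<lambda>_. \<pi>) h x)" for \<tau>
    using rollout_cum_reward_bounds[OF assms(1,2), of \<tau> \<theta> \<omega> "\<lambda>_. \<pi>" "Suc H - h" "[]"]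
      rollout_Dead[OF assms(1,2), of \<omega> \<tau> \<theta> "\<lambda>_. \<pi>" "Suc H - h" "[]"] that
    by (auto simp: rollout_from_def)
  have "measure_pmf.expectation (rollout_from (mdp_of \<theta> \<omega>) (\<lambda>_. \<pi>) h x) cum_reward
    \<le> measure_pmf.expectation (rollout_from (mdp_of \<theta> \<omega>) (\<lambda>_. \<pi>) h x)
        (\<lambda>_. of_bool (clss \<omega> x \<noteq> Dead))"
  proof (rule integral_mono_AE)
    show "integrable (rollout_from (mdp_of \<theta> \<omega>) (\<lambda>_. \<pi>) h x) cum_reward"
      by (rule measure_pmf.integrable_const_bound[where B = 1])
         (use * in \<open>auto simp: AE_measure_pmf_iff\<close>)
  qed (use * in \<open>auto simp: AE_measure_pmf_iff\<close>)
  then show ?thesis by (simp add: state_value_def)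
qed

lemma pol_in_policies: "pol \<theta> \<in> policies (mdp_of \<theta>' \<omega>)"
  by (auto simp: policies_def state_space_def pol_def bit_at_def)

lemma finite_policies: "finite (policies (mdp_of \<theta> \<omega>))"
  unfolding policies_def by (intro finite_PiE) (auto simp: state_space_def)

lemma realizable_mdp_of:
  assumes "\<theta> \<in> \<Theta>"
  shows "realizable (pol ` \<Theta>) (mdp_of \<theta> \<omega>)"
  unfolding realizable_def
proof (intro bexI ballI)
  fix h x assume "h \<in> {1..horizon (mdp_of \<theta> \<omega>)}" "x \<in> layer (mdp_of \<theta> \<omega>) h"
  then have hx: "x \<in> X h" "1 \<le> h" "h \<le> H" by auto
  let ?V = "\<lambda>\<pi>. state_value (mdp_of \<theta> \<omega>) \<pi> h x"
  show "?V (pol \<theta>) = Max (?V ` policies (mdp_of \<theta> \<omega>))"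
  proof (rule Max_eqI[symmetric])
    show "finite (?V ` policies (mdp_of \<theta> \<omega>))"
      by (intro finite_imageI finite_policies)
    show "v \<le> ?V (pol \<theta>)" if "v \<in> ?V ` policies (mdp_of \<theta> \<omega>)" for v
      using that unfolding state_value_pol[OF hx] by (auto simp only: state_value_le[OF hx])
  qed (intro imageI pol_in_policies)
qed (use assms in auto)

lemma clss_first: "x \<in> X (Suc 0) \<Longrightarrow> clss \<omega> x = Good"
  by (simp add: clss_X cl_def)

lemma policy_value_pol: "policy_value (mdp_of \<theta> \<omega>) (pol \<theta>) = 1"
  unfolding policy_value_def
  by (rule expectation_pmf_const) (use K_less in \<open>auto simp: state_value_pol clss_first\<close>)

lemma policy_value_mismatch:
  assumes "\<theta>' \<inter> {1..K} \<noteq> \<theta> \<inter> {1..K}"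
  shows "policy_value (mdp_of \<theta> \<omega>) (pol \<theta>') = 0"
  unfolding policy_value_def
proof (rule expectation_pmf_const)
  fix x assume "x \<in> set_pmf (init (mdp_of \<theta> \<omega>))"
  then have x: "x \<in> X 1" by simp
  have "\<exists>i\<in>{1..K}. (i \<in> \<theta>) \<noteq> (i \<in> \<theta>')" using assms by blast
  show "state_value (mdp_of \<theta> \<omega>) (pol \<theta>') 1 x = 0"
    unfolding state_value_def
  proof (rule expectation_pmf_const)
    fix \<tau> assume "\<tau> \<in> set_pmf (rollout_from (mdp_of \<theta> \<omega>) (\<lambda>_. pol \<theta>') 1 x)"
    then show "cum_reward \<tau> = 0"
      using rollout_pol_mismatch[OF x _ _ _ \<open>\<exists>i\<in>{1..K}. _\<close>] x K_ge
      by (simp add: rollout_from_def clss_first)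
  qed
qed

text \<open>\<open>pol \<theta>\<close> has value 1 and a policy with a mismatch in the first
  \<open>K\<close> layers has value 0, so an error below 1 forces agreement there.\<close>

lemma eps_optimal_pol_agrees:
  assumes "\<theta> \<in> \<Theta>" "finite \<Theta>" "eps_optimal (pol ` \<Theta>) (mdp_of \<theta> \<omega>) (1/8) (pol \<theta>')"
  shows "\<theta>' \<inter> {1..K} = \<theta> \<inter> {1..K}"
proof (rule ccontr)
  assume "\<theta>' \<inter> {1..K} \<noteq> \<theta> \<inter> {1..K}"
  then have "policy_value (mdp_of \<theta> \<omega>) (pol \<theta>') = 0" by (rule policy_value_mismatch)
  moreover have "1 \<le> Max (policy_value (mdp_of \<theta> \<omega>) ` pol ` \<Theta>)"
    using assms by (intro Max_ge) (auto simp: image_iff policy_value_pol intro!: bexI[of _ \<theta>])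
  ultimately show False using assms(3) by (simp add: eps_optimal_def)
qed

section \<open>Concentrability\<close>

lemma rollout_prefix:
  "\<tau> \<in> set_pmf (rollout M \<sigma> k \<tau>0 x) \<Longrightarrow> \<exists>\<tau>1. \<tau> = \<tau>0 @ \<tau>1"
proof (induction k arbitrary: x \<tau>0)
  case (Suc k)
  then obtain r x' where "\<tau> \<in> set_pmf (rollout M \<sigma> k (\<tau>0 @ [(x, \<sigma> \<tau>0 x, r)]) x')"
    by (auto simp: Let_def)
  from Suc.IH[OF this] show ?case by auto
qed simp

lemma rollout_prefix_Suc:
  "\<tau> \<in> set_pmf (rollout M \<sigma> (Suc k) \<tau>0 x) \<Longrightarrow> \<exists>r \<tau>1. \<tau> = \<tau>0 @ (x, \<sigma> \<tau>0 x, r) # \<tau>1"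
proof -
  assume "\<tau> \<in> set_pmf (rollout M \<sigma> (Suc k) \<tau>0 x)"
  then obtain r x' where "\<tau> \<in> set_pmf (rollout M \<sigma> k (\<tau>0 @ [(x, \<sigma> \<tau>0 x, r)]) x')"
    by (auto simp: Let_def)
  from rollout_prefix[OF this] show ?thesis by auto
qed

text \<open>Given the past, the state of layer \<open>h'\<close> is uniform on a cell of Good or
  Dead, since these two classes lead only to each other or themselves; by
  \<open>frac_reachable\<close> such a cell has at least \<open>n * S / 4\<close> states.\<close>

lemma pmf_state_at_le:
  assumes "valid h c" "c = Good \<or> c = Dead" "1 \<le> h" "h \<le> h'" "h' \<le> H"
    "length \<tau>0 = h - 1" "h + k = Suc H" 
  shows "pmf (bind_pmf (pmf_of_set (cell \<omega> h c)) (\<lambda>x.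
           map_pmf (\<lambda>\<tau>. fst (\<tau> ! (h' - 1))) (rollout (mdp_of \<theta> \<omega>) (\<lambda>_. \<pi>) k \<tau>0 x))) y
         \<le> 4 / real (n * S)"
  using assms
proof (induction k arbitrary: h c \<tau>0)
  case (Suc k)
  have ne: "cell \<omega> h c \<noteq> {}" using Suc.prems(1) by (rule cell_nonempty)
  show ?case
  proof (cases "h = h'")
    case True
    \<comment> \<open>\<open>\<tau>0\<close> has length \<open>h - 1\<close>, so the entry at index
      \<open>h' - 1\<close> is the one recorded for the current state.\<close>
    have *: "map_pmf (\<lambda>\<tau>. fst (\<tau> ! (h' - 1))) (rollout (mdp_of \<theta> \<omega>) (\<lambda>_. \<pi>) (Suc k) \<tau>0 x)
      = return_pmf x" for x
    proof -
      have "map_pmf (\<lambda>\<tau>. fst (\<tau> ! (h' - 1))) (rollout (mdp_of \<theta> \<omega>) (\<lambda>_. \<pi>) (Suc k) \<tau>0 x)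
        = map_pmf (\<lambda>_. x) (rollout (mdp_of \<theta> \<omega>) (\<lambda>_. \<pi>) (Suc k) \<tau>0 x)"
      proof (rule map_pmf_cong[OF refl])
        fix \<tau> assume "\<tau> \<in> set_pmf (rollout (mdp_of \<theta> \<omega>) (\<lambda>_. \<pi>) (Suc k) \<tau>0 x)"
        from rollout_prefix_Suc[OF this] Suc.prems(6) True
        show "fst (\<tau> ! (h' - 1)) = x" by (auto simp: nth_append)
      qed
      then show ?thesis by (simp add: map_pmf_const)
    qed
    have "pmf (pmf_of_set (cell \<omega> h c)) y \<le> 1 / real (card (cell \<omega> h c))"
      using ne by (simp add: indicator_def)
    also have "\<dots> \<le> 4 / real (n * S)"
      using frac_reachable[OF Suc.prems(1,2)] frac_pos[OF Suc.prems(1)] n_pos S_pos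
      unfolding real_card_cell by (simp add: field_simps)
    finally show ?thesis by (simp only: * bind_return_pmf')
  next
    case False
    \<comment> \<open>States of the same cell may receive different actions; the bound is shown for
      each of them, and a mixture keeps it.\<close>
    show ?thesis
    proof (rule pmf_bind_le_const)
      fix x assume "x \<in> set_pmf (pmf_of_set (cell \<omega> h c))"
      then have x: "x \<in> X h" "clss \<omega> x = c" using ne by (auto simp: cell_def)
      let ?c = "nxt \<theta> h c (\<pi> x)"
      have IH: "pmf (bind_pmf (pmf_of_set (cell \<omega> (Suc h) ?c)) (\<lambda>x'.
           map_pmf (\<lambda>\<tau>. fst (\<tau> ! (h' - 1)))
             (rollout (mdp_of \<theta> \<omega>) (\<lambda>_. \<pi>) k (\<tau>0 @ [(x, \<pi> x, rew \<theta> h c (\<pi> x))]) x'))) y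
         \<le> 4 / real (n * S)"
      proof (rule Suc.IH)
        show "valid (Suc h) ?c" using Suc.prems(1,3) by (intro valid_nxt)
        show "?c = Good \<or> ?c = Dead" using Suc.prems(2) by (auto split: if_splits)
      qed (use Suc.prems False in auto)
      show "pmf (map_pmf (\<lambda>\<tau>. fst (\<tau> ! (h' - 1)))
              (rollout (mdp_of \<theta> \<omega>) (\<lambda>_. \<pi>) (Suc k) \<tau>0 x)) y \<le> 4 / real (n * S)"
        using IH x by (simp add: Let_def mdp_of_def bind_return_pmf map_bind_pmf)
    qed
  qed
qed simp

lemma C_all_le: "C_all (\<lambda>h. pmf_of_set (X h)) (mdp_of \<theta> \<omega>) \<le> 4"
  unfolding C_all_def
proof (intro SUP_least)
  fix \<pi> h assume "h \<in> {1..horizon (mdp_of \<theta> \<omega>)}"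
  then have h: "1 \<le> h" "h \<le> H" by auto
  \<comment> \<open>Layer 1 is its own cell of Good, so the initial distribution has the form
    treated in \<open>pmf_state_at_le\<close>.\<close>
  have "pmf (occupancy (mdp_of \<theta> \<omega>) \<pi> h) y \<le> 4 / real (n * S)" for y
    unfolding occupancy_def rollout_from_def map_bind_pmf
    using pmf_state_at_le[of 1 Good h "[]" H \<omega> \<theta> \<pi> y] h
    by (simp add: valid_def cell_first)
  then have "ennreal (pmf (occupancy (mdp_of \<theta> \<omega>) \<pi> h) y) \<le> ennreal (4 / real (n * S))" for y
    by (rule ennreal_leI)
  also have "ennreal (4 / real (n * S)) = 4 * ennreal (1 / real (n * S))"
    by (subst ennreal_numeral[symmetric], subst ennreal_mult[symmetric]) simp_all
  finally have "ennreal (pmf (occupancy (mdp_of \<theta> \<omega>) \<pi> h) y) \<le> 4 * ennreal (pmf (pmf_of_set (X h)) y)"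
    if "y \<in> X h" for y
    using that by (simp add: card_X)
  then show "ratio_norm (layer (mdp_of \<theta> \<omega>) h) (occupancy (mdp_of \<theta> \<omega>) \<pi> h) (pmf_of_set (X h)) \<le> 4"
    unfolding ratio_norm_def by (intro Inf_lower) auto
qed

end

section \<open>Independence of coordinates\<close>

declare rollout.simps(2) [simp del]

text \<open>A function that ignores coordinate \<open>i\<close> is independent of it under a product
  distribution. This pointwise form is closed under products.\<close>

definition insens :: "(('i \<Rightarrow> 'v) \<Rightarrow> real) \<Rightarrow> 'i \<Rightarrow> bool" where
  "insens g i \<longleftrightarrow> (\<forall>\<omega> v. g (fun_upd \<omega> i v) = g \<omega>)"

lemma insens_mult: "insens f i \<Longrightarrow> insens g i \<Longrightarrow> insens (\<lambda>\<omega>. f \<omega> * g \<omega>) i"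
  by (simp add: insens_def)

text \<open>Splitting off coordinate \<open>i\<close> turns the product law into a pair of
  independent parts, and \<open>g\<close> depends on the second part only.\<close>

lemma expectation_Pi_pmf_insens:
  fixes f :: "'v \<Rightarrow> real"
  assumes A: "finite A" "i \<in> A" and fin: "\<And>j. j \<in> A \<Longrightarrow> finite (set_pmf (p j))"
    and g: "insens g i"
  shows "measure_pmf.expectation (Pi_pmf A d p) (\<lambda>\<omega>. f (\<omega> i) * g \<omega>) =
    measure_pmf.expectation (p i) f * measure_pmf.expectation (Pi_pmf A d p) g"
proof -
  define B where "B = A - {i}"
  have AB: "A = insert i B" "i \<notin> B" "finite B" using A by (auto simp: B_def)
  define Q where "Q = Pi_pmf B d p"
  have finQ: "finite (set_pmf Q)"
    unfolding Q_def using fin AB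
    by (intro finite_subset[OF set_Pi_pmf_subset'] finite_PiE_dflt) auto
  have P: "Pi_pmf A d p = map_pmf (\<lambda>(y, f). f(i := y)) (pair_pmf (p i) Q)"
    unfolding AB(1) Q_def using AB by (intro Pi_pmf_insert)
  have *: "measure_pmf.expectation (Pi_pmf A d p) (\<lambda>\<omega>. u (\<omega> i) * g \<omega>) =
    measure_pmf.expectation (p i) u * measure_pmf.expectation Q g" for u :: "'v \<Rightarrow> real"
  proof -
    have "measure_pmf.expectation (Pi_pmf A d p) (\<lambda>\<omega>. u (\<omega> i) * g \<omega>)
      = measure_pmf.expectation (pair_pmf (p i) Q) (\<lambda>(y, \<omega>). u y * g \<omega>)"
      unfolding P using g by (simp add: case_prod_unfold insens_def)
    also have "\<dots> = (\<Sum>(y, \<omega>)\<in>set_pmf (p i) \<times> set_pmf Q. pmf (p i) y * pmf Q \<omega> * (u y * g \<omega>))"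
      by (subst integral_measure_pmf[where A = "set_pmf (p i) \<times> set_pmf Q"])
         (use fin A finQ in \<open>auto simp: pmf_pair case_prod_unfold intro!: sum.cong\<close>)
    also have "\<dots> = (\<Sum>y\<in>set_pmf (p i). pmf (p i) y * u y) * (\<Sum>\<omega>\<in>set_pmf Q. pmf Q \<omega> * g \<omega>)"
      unfolding sum_product sum.cartesian_product by (intro sum.cong) auto
    also have "\<dots> = measure_pmf.expectation (p i) u * measure_pmf.expectation Q g"
      by (subst (1 2) integral_measure_pmf[OF _ _]) (use fin A finQ in auto)
    finally show ?thesis .
  qed
  \<comment> \<open>The constant function 1 shows that \<open>g\<close> has the same mean under
    \<open>Q\<close> and under the full product.\<close>
  show ?thesis using *[of f] *[of "\<lambda>_. 1"] by simp
qed

definition acts :: "('s, 'a) traj \<Rightarrow> 'a list" where "acts \<tau> = map (fst \<circ> snd) \<tau>"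

lemma acts_simps [simp]: "acts [] = []" "acts ((x, a, r) # \<tau>) = a # acts \<tau>"
  by (simp_all add: acts_def)

section \<open>Averaging a rollout over the shifts\<close>

context hard_family begin

text \<open>Layer \<open>Suc H\<close> is included because the successor drawn after the last layer
  has a class that is averaged out too.\<close>

definition blocks :: "(nat \<times> nat) set" where "blocks = {1..Suc H} \<times> {..<n}"

definition prior :: "(nat \<times> nat \<Rightarrow> nat) pmf" where
  "prior = Pi_pmf blocks 0 (\<lambda>_. pmf_of_set {..<S})"

lemma set_shift [simp]: "set_pmf (pmf_of_set {..<S}) = {..<S}"
  using S_pos by (intro set_pmf_of_set) (auto simp: lessThan_empty_iff)

lemma finite_set_prior [simp]: "finite (set_pmf prior)"
  unfolding prior_def
  by (rule finite_subset[OF set_Pi_pmf_subset']) (auto simp: blocks_def S_pos intro!: finite_PiE_dflt)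

lemma integrable_prior [simp]: "integrable (measure_pmf prior) (f :: _ \<Rightarrow> real)"
  by (intro integrable_measure_pmf_finite) simp

text \<open>A uniform shift makes the shifted position of a fixed state uniform, so its class has
  the law \<open>frac h\<close>, independently of whatever ignores its block.\<close>

lemma prior_clss:
  assumes x: "x \<in> X h" "1 \<le> h" "h \<le> Suc H" and g: "insens g (blk x)"
  shows "measure_pmf.expectation prior (\<lambda>\<omega>. of_bool (clss \<omega> x = c) * g \<omega>) =
    frac h c * measure_pmf.expectation prior g"
proof -
  have "blk x \<in> blocks"
    using x snd_blk_X[OF x(1)] lay_X[OF x(1)] fst_blk[of x]
    by (cases "blk x") (auto simp: blocks_def)
  then have "measure_pmf.expectation prior
      (\<lambda>\<omega>. of_bool (cl h ((pos x + \<omega> (blk x)) mod S) = c) * g \<omega>) =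
    measure_pmf.expectation (pmf_of_set {..<S}) (\<lambda>v. of_bool (cl h ((pos x + v) mod S) = c))
      * measure_pmf.expectation prior g"
    unfolding prior_def using g
    by (intro expectation_Pi_pmf_insens[where f = "\<lambda>v. of_bool (cl h ((pos x + v) mod S) = c)"])
       (auto simp: blocks_def S_pos)
  also have "measure_pmf.expectation (pmf_of_set {..<S}) (\<lambda>v. of_bool (cl h ((pos x + v) mod S) = c))
    = real (card {v \<in> {..<S}. cl h ((v + pos x) mod S) = c}) / real S"
    using S_pos by (subst integral_pmf_of_set) (auto simp: add.commute Int_def)
  also have "\<dots> = frac h c"
    by (simp only: card_shift_mod[where P = "\<lambda>v. cl h v = c"] frac_def)
  finally show ?thesis using x by (simp add: clss_X)
qed

text \<open>
  What the learner sees on average: uniform observations and a reward at layer \<open>K\<close> that is a coin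
  flip \<open>b\<close> drawn at the start of the round.
\<close>

definition ideal :: "bool \<Rightarrow> (nat, nat) mdp" where
  "ideal b =
     \<lparr>layer = X, actions = {0, 1}, horizon = H,
      trans = \<lambda>x a. pmf_of_set (X (Suc (lay x))),
      reward = \<lambda>x a. return_pmf (of_bool (b \<and> lay x = K)),
      init = pmf_of_set (X 1)\<rparr>"

text \<open>From latent class \<open>c\<close> at layer \<open>h\<close>, the actions produce the rewards of \<open>ideal b\<close>.\<close>

fun consistent :: "nat set \<Rightarrow> bool \<Rightarrow> nat \<Rightarrow> cls \<Rightarrow> nat list \<Rightarrow> bool" where
  "consistent \<theta> b h c [] \<longleftrightarrow> True"
| "consistent \<theta> b h c (a # as) \<longleftrightarrow>
     rew \<theta> h c a = of_bool (b \<and> h = K) \<and> consistent \<theta> b (Suc h) (nxt \<theta> h c a) as"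

lemma horizon_ideal [simp]: "horizon (ideal b) = H"
  by (simp add: ideal_def)

lemma pmf_rollout_ideal_Suc:
  assumes "x \<in> X h"
  shows "pmf (rollout (ideal b) \<sigma> (Suc k) \<tau>0 x) \<tau> =
    (\<Sum>y\<in>X (Suc h). pmf (rollout (ideal b) \<sigma> k (\<tau>0 @ [(x, \<sigma> \<tau>0 x, of_bool (b \<and> h = K))]) y) \<tau>)
      / real (n * S)"
  using assms by (simp add: rollout.simps(2) ideal_def Let_def bind_return_pmf pmf_bind_pmf_of_set card_X)

text \<open>Compared with the ideal step, the sum keeps only one cell and the denominator gains a
  factor \<open>frac\<close>; averaged over the shift of \<open>y\<close> the two effects
  cancel.\<close>

lemma pmf_rollout_mdp_Suc:
  fixes \<sigma> \<tau>0
  assumes "x \<in> X h" "1 \<le> h"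
  defines "a \<equiv> \<sigma> \<tau>0 x"
  shows "pmf (rollout (mdp_of \<theta> \<omega>) \<sigma> (Suc k) \<tau>0 x) \<tau> =
    (\<Sum>y\<in>X (Suc h). of_bool (clss \<omega> y = nxt \<theta> h (clss \<omega> x) a) *
       pmf (rollout (mdp_of \<theta> \<omega>) \<sigma> k (\<tau>0 @ [(x, a, rew \<theta> h (clss \<omega> x) a)]) y) \<tau>)
      / (real (n * S) * frac (Suc h) (nxt \<theta> h (clss \<omega> x) a))"
proof -
  let ?c = "nxt \<theta> h (clss \<omega> x) a"
  have ne: "cell \<omega> (Suc h) ?c \<noteq> {}"
    using assms by (intro cell_nonempty valid_nxt valid_clss)
  have "pmf (rollout (mdp_of \<theta> \<omega>) \<sigma> (Suc k) \<tau>0 x) \<tau> =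
    (\<Sum>y\<in>cell \<omega> (Suc h) ?c.
       pmf (rollout (mdp_of \<theta> \<omega>) \<sigma> k (\<tau>0 @ [(x, a, rew \<theta> h (clss \<omega> x) a)]) y) \<tau>)
      / (real (n * S) * frac (Suc h) ?c)"
    using assms(1) ne
    by (simp add: rollout.simps(2) a_def mdp_of_def Let_def bind_return_pmf pmf_bind_pmf_of_set real_card_cell)
  also have "(\<Sum>y\<in>cell \<omega> (Suc h) ?c.
       pmf (rollout (mdp_of \<theta> \<omega>) \<sigma> k (\<tau>0 @ [(x, a, rew \<theta> h (clss \<omega> x) a)]) y) \<tau>)
    = (\<Sum>y\<in>X (Suc h). of_bool (clss \<omega> y = ?c) *
       pmf (rollout (mdp_of \<theta> \<omega>) \<sigma> k (\<tau>0 @ [(x, a, rew \<theta> h (clss \<omega> x) a)]) y) \<tau>)"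
    by (rule sum.mono_neutral_cong_left) (auto simp: cell_def)
  finally show ?thesis .
qed

text \<open>
  The class of the current state is integrated out at each step. The factor \<open>g\<close> stands for the
  other rounds of the history; it may not depend on layer \<open>Suc H\<close> because \<^const>\<open>rollout\<close> also draws
  a successor of the last state.
\<close>

lemma rollout_lower:
  assumes "x \<in> X h" "1 \<le> h" "h + k = Suc H" "valid h c" "\<And>\<omega>. 0 \<le> g \<omega>"
    "consistent \<theta> b h c (acts (drop (length \<tau>0) \<tau>))"
    "distinct (map (blk \<circ> fst) (drop (length \<tau>0) \<tau>))"
    "\<And>i. i \<in> (blk \<circ> fst) ` set (drop (length \<tau>0) \<tau>) \<Longrightarrow> insens g i"
    "\<And>j. insens g (Suc H, j)"
  shows "frac h c * pmf (rollout (ideal b) \<sigma> k \<tau>0 x) \<tau> * measure_pmf.expectation prior g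
    \<le> measure_pmf.expectation prior
        (\<lambda>\<omega>. of_bool (clss \<omega> x = c) * (pmf (rollout (mdp_of \<theta> \<omega>) \<sigma> k \<tau>0 x) \<tau> * g \<omega>))"
  using assms
proof (induction k arbitrary: x h c \<tau>0 g)
  case 0
  \<comment> \<open>Here \<open>x\<close> lies in layer \<open>Suc H\<close>, so the last hypothesis
    applies to its block.\<close>
  have "insens g (blk x)"
    using 0 lay_X[of x h] fst_blk[of x] by (metis add.right_neutral prod.collapse)
  moreover have "measure_pmf.expectation prior
        (\<lambda>\<omega>. of_bool (clss \<omega> x = c) * (pmf (rollout (mdp_of \<theta> \<omega>) \<sigma> 0 \<tau>0 x) \<tau> * g \<omega>))
      = pmf (return_pmf \<tau>0) \<tau> * measure_pmf.expectation prior (\<lambda>\<omega>. of_bool (clss \<omega> x = c) * g \<omega>)"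
    by (simp add: mult_ac flip: integral_mult_right_zero)
  ultimately show ?case using 0 by (simp add: prior_clss)
next
  case (Suc k)
  show ?case
  proof (cases "pmf (rollout (ideal b) \<sigma> (Suc k) \<tau>0 x) \<tau> = 0")
    case True
    then show ?thesis using Suc.prems(5) by (simp add: integral_nonneg)
  next
    case False
    let ?E = "measure_pmf.expectation prior"
    define a where "a = \<sigma> \<tau>0 x"
    define r :: real where "r = of_bool (b \<and> h = K)"
    define c' where "c' = nxt \<theta> h c a"
    define f' where "f' = frac (Suc h) c'"
    define \<tau>0' where "\<tau>0' = \<tau>0 @ [(x, a, r)]"
    \<comment> \<open>A nonzero ideal probability forces \<open>\<tau>\<close> to continue
      \<open>\<tau>0\<close> with the entry for \<open>x\<close>.\<close>
    have "(\<Sum>y\<in>X (Suc h). pmf (rollout (ideal b) \<sigma> k \<tau>0' y) \<tau>) \<noteq> 0"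
      using False Suc.prems(1) by (auto simp: pmf_rollout_ideal_Suc a_def r_def \<tau>0'_def)
    then obtain y where "pmf (rollout (ideal b) \<sigma> k \<tau>0' y) \<tau> \<noteq> 0"
      by (meson sum.neutral)
    then obtain \<tau>1 where \<tau>: "\<tau> = \<tau>0' @ \<tau>1"
      using rollout_prefix by (metis set_pmf_iff)
    have dr: "drop (length \<tau>0) \<tau> = (x, a, r) # \<tau>1" "drop (length \<tau>0') \<tau> = \<tau>1"
      by (simp_all add: \<tau> \<tau>0'_def)
    have rew: "rew \<theta> h c a = r" and cons: "consistent \<theta> b (Suc h) c' (acts \<tau>1)"
      using Suc.prems(6) by (simp_all add: dr r_def c'_def)
    have val: "valid (Suc h) c'" using Suc.prems(2,4) by (simp add: c'_def valid_nxt)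
    have f': "0 < f'" using val by (simp add: f'_def frac_pos)
    \<comment> \<open>The event that \<open>x\<close> has class \<open>c\<close> joins the weight.
      The induction hypothesis accepts the new weight because the block of \<open>x\<close> does not
      recur later in \<open>\<tau>\<close>.\<close>
    define g' where "g' = (\<lambda>\<omega>. of_bool (clss \<omega> x = c) * g \<omega>)"
    have insx: "insens (\<lambda>\<omega>. of_bool (clss \<omega> x = c)) i" if "i \<noteq> blk x" for i
      using that by (auto simp: insens_def clss_def)
    have Eg': "?E g' = frac h c * ?E g"
      unfolding g'_def using Suc.prems by (intro prior_clss) (auto simp: dr)
    have step: "f' * pmf (rollout (ideal b) \<sigma> k \<tau>0' y) \<tau> * ?E g'
      \<le> ?E (\<lambda>\<omega>. of_bool (clss \<omega> y = c') * (pmf (rollout (mdp_of \<theta> \<omega>) \<sigma> k \<tau>0' y) \<tau> * g' \<omega>))"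
      if y: "y \<in> X (Suc h)" for y
      unfolding f'_def
    proof (rule Suc.IH)
      show "insens g' i" if "i \<in> (blk \<circ> fst) ` set (drop (length \<tau>0') \<tau>)" for i
      proof -
        have "i \<in> (blk \<circ> fst) ` set \<tau>1" using that by (simp add: dr)
        moreover have "blk x \<notin> (blk \<circ> fst) ` set \<tau>1"
          using Suc.prems(7) unfolding dr by simp
        then have "i \<noteq> blk x" using calculation by metis
        ultimately show ?thesis
          unfolding g'_def using Suc.prems(8)[of i] by (intro insens_mult insx) (auto simp: dr)
      qed
      show "insens g' (Suc H, j)" for j
      proof -
        have "(Suc H, j) \<noteq> blk x"
          using lay_X[OF Suc.prems(1)] Suc.prems(3) fst_blk[of x] by (metis fst_conv n_not_Suc_n add_Suc_right add_eq_self_zero nat.distinct(1))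
        then show ?thesis
          unfolding g'_def using Suc.prems(9) by (intro insens_mult insx)
      qed
    qed (use y val cons Suc.prems in \<open>auto simp: g'_def dr\<close>)
    \<comment> \<open>Multiplying and dividing by \<open>f'\<close> yields the left side of
      \<open>step\<close> and the denominator of \<open>pmf_rollout_mdp_Suc\<close>.\<close>
    have "frac h c * pmf (rollout (ideal b) \<sigma> (Suc k) \<tau>0 x) \<tau> * ?E g
      = (\<Sum>y\<in>X (Suc h). f' * pmf (rollout (ideal b) \<sigma> k \<tau>0' y) \<tau> * ?E g') / (real (n * S) * f')"
      using f' Suc.prems(1)
      by (simp add: pmf_rollout_ideal_Suc Eg' a_def r_def \<tau>0'_def mult_ac
               flip: sum_distrib_left sum_distrib_right)
    also have "\<dots> \<le> (\<Sum>y\<in>X (Suc h). ?E (\<lambda>\<omega>. of_bool (clss \<omega> y = c') *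
        (pmf (rollout (mdp_of \<theta> \<omega>) \<sigma> k \<tau>0' y) \<tau> * g' \<omega>))) / (real (n * S) * f')"
      using f' by (intro divide_right_mono sum_mono step) auto
    also have "\<dots> = ?E (\<lambda>\<omega>. (\<Sum>y\<in>X (Suc h). of_bool (clss \<omega> y = c') *
        (pmf (rollout (mdp_of \<theta> \<omega>) \<sigma> k \<tau>0' y) \<tau> * g' \<omega>)) / (real (n * S) * f'))"
      by (simp only: integral_divide_zero Bochner_Integration.integral_sum integrable_prior)
    also have "\<dots> = ?E (\<lambda>\<omega>. of_bool (clss \<omega> x = c) *
        (pmf (rollout (mdp_of \<theta> \<omega>) \<sigma> (Suc k) \<tau>0 x) \<tau> * g \<omega>))"
    proof (rule Bochner_Integration.integral_cong[OF refl])
      fix \<omega>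
      show "(\<Sum>y\<in>X (Suc h). of_bool (clss \<omega> y = c') *
        (pmf (rollout (mdp_of \<theta> \<omega>) \<sigma> k \<tau>0' y) \<tau> * g' \<omega>)) / (real (n * S) * f')
        = of_bool (clss \<omega> x = c) * (pmf (rollout (mdp_of \<theta> \<omega>) \<sigma> (Suc k) \<tau>0 x) \<tau> * g \<omega>)"
      proof (cases "clss \<omega> x = c")
        case True
        then show ?thesis
          unfolding pmf_rollout_mdp_Suc[OF Suc.prems(1,2)] a_def[symmetric] True c'_def[symmetric]
            rew f'_def[symmetric] \<tau>0'_def[symmetric]
          by (simp add: g'_def True sum_distrib_right mult.assoc)
      qed (simp add: g'_def)
    qed
    finally show ?thesis .
  qed
qed

text \<open>The shifts enter only through the classes of the visited states, because cell sizes do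
  not depend on them.\<close>

lemma insens_rollout:
  assumes "i \<notin> (blk \<circ> fst) ` set \<tau>" "x \<in> X h" "1 \<le> h"
  shows "pmf (rollout (mdp_of \<theta> (fun_upd \<omega> i v)) \<sigma> k \<tau>0 x) \<tau> = pmf (rollout (mdp_of \<theta> \<omega>) \<sigma> k \<tau>0 x) \<tau>"
  using assms
proof (induction k arbitrary: x h \<tau>0)
  case (Suc k)
  have zero: "pmf (rollout (mdp_of \<theta> \<omega>) \<sigma> (Suc k) \<tau>0 x) \<tau> = 0"
    if "x \<notin> fst ` set \<tau>" for \<omega> k \<tau>0 x
    using that rollout_prefix_Suc[of \<tau> "mdp_of \<theta> \<omega>" \<sigma> k \<tau>0 x]
    by (force simp: set_pmf_iff)
  have cl: "clss (fun_upd \<omega> i v) y = clss \<omega> y" if "y \<in> fst ` set \<tau>" for y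
    using that Suc.prems(1) by (auto simp: clss_def)
  show ?case
  proof (cases "x \<in> fst ` set \<tau>")
    case True
    show ?thesis
    proof (cases k)
      \<comment> \<open>The successor of the last recorded state is drawn and discarded, so its
        class has no influence.\<close>
      case 0
      then show ?thesis using Suc.prems(2) cl[OF True]
        by (simp add: rollout.simps(2) mdp_of_def Let_def bind_return_pmf del: fun_upd_apply)
    next
      case k: (Suc k')
      show ?thesis
        unfolding pmf_rollout_mdp_Suc[OF Suc.prems(2,3)] cl[OF True]
      proof (intro arg_cong2[where f = "(/)"] sum.cong refl)
        fix y assume y: "y \<in> X (Suc h)"
        let ?\<tau> = "\<tau>0 @ [(x, \<sigma> \<tau>0 x, rew \<theta> h (clss \<omega> x) (\<sigma> \<tau>0 x))]"
        let ?c = "nxt \<theta> h (clss \<omega> x) (\<sigma> \<tau>0 x)"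
        show "of_bool (clss (fun_upd \<omega> i v) y = ?c) * pmf (rollout (mdp_of \<theta> (fun_upd \<omega> i v)) \<sigma> k ?\<tau> y) \<tau>
          = of_bool (clss \<omega> y = ?c) * pmf (rollout (mdp_of \<theta> \<omega>) \<sigma> k ?\<tau> y) \<tau>"
        proof (cases "y \<in> fst ` set \<tau>")
          case y\<tau>: True
          show ?thesis by (simp only: cl[OF y\<tau>] Suc.IH[OF Suc.prems(1) y])
        next
          \<comment> \<open>An unvisited \<open>y\<close> may change its class with the shift, but
            then both sides vanish, since a rollout of positive length records
            \<open>y\<close>.\<close>
          case False
          then show ?thesis unfolding k zero[OF False] by simp
        qed
      qed
    qed
  next
    case False
    show ?thesis unfolding zero[OF False] ..
  qed
qed simp

end

section \<open>Comparison of a single round\<close>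

lemma UNIV_cls: "(UNIV :: cls set) = {Good, Junk, Free, Dead}"
  using cls.exhaust by auto

lemma sum_of_bool_eq_le_1: "finite C \<Longrightarrow> (\<Sum>c\<in>C. of_bool (d = c) :: real) \<le> 1"
  by (simp add: of_bool_def sum.delta)

context hard_family begin

fun agree_early :: "nat set \<Rightarrow> nat \<Rightarrow> nat list \<Rightarrow> bool" where
  "agree_early \<theta> h [] \<longleftrightarrow> True"
| "agree_early \<theta> h (a # as) \<longleftrightarrow> (h \<le> K \<longrightarrow> a = bit_at \<theta> h) \<and> agree_early \<theta> (Suc h) as"

fun agree_late :: "nat set \<Rightarrow> nat \<Rightarrow> nat list \<Rightarrow> bool" where
  "agree_late \<theta> h [] \<longleftrightarrow> True"
| "agree_late \<theta> h (a # as) \<longleftrightarrow> (K < h \<longrightarrow> a = bit_at \<theta> h) \<and> agree_late \<theta> (Suc h) as"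

lemma agree_early_late: "K < h \<Longrightarrow> agree_early \<theta> h as"
  by (induction as arbitrary: h) auto

lemma consistent_Dead: "\<not> b \<or> K < h \<Longrightarrow> consistent \<theta> b h Dead as"
  by (induction as arbitrary: h) auto

lemma consistent_Free: "h \<le> K \<Longrightarrow> consistent \<theta> True h Free as"
  by (induction as arbitrary: h) (auto simp: consistent_Dead)

text \<open>The actions decide which coin Good imitates: true exactly under agreement up to
  \<open>K\<close>. Junk imitates the opposite coin, so the pair looks like a fair coin whatever the
  actions are.\<close>

lemma consistent_Good: "h \<le> K \<Longrightarrow> consistent \<theta> (agree_early \<theta> h as) h Good as"
  by (induction as arbitrary: h) (auto simp: consistent_Dead agree_early_late)

text \<open>Ideal rewards vanish after \<open>K\<close>, and the lock pays only at \<open>H\<close>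
  after uninterrupted agreement; one late disagreement makes it silent.\<close>

lemma consistent_Junk_late:
  "K < h \<Longrightarrow> h + length as \<le> Suc H \<Longrightarrow> \<not> agree_late \<theta> h as \<Longrightarrow> consistent \<theta> b h Junk as"
proof (induction as arbitrary: h)
  case (Cons a as)
  show ?case
  proof (cases "h < H")
    case True
    then show ?thesis using Cons.prems Cons.IH[of "Suc h"] by (auto simp: consistent_Dead)
  next
    case False
    then have "h = H" using Cons.prems(2) by simp
    then have "as = []" using Cons.prems(2) by simp
    then show ?thesis using Cons.prems \<open>h = H\<close> by auto
  qed
qed simp

text \<open>An early disagreement leads to Free, or pays directly if it happens at \<open>K\<close>.
  Full early agreement enters the lock, which stays silent by
  \<open>consistent_Junk_late\<close>.\<close>

lemma consistent_Junk:
  "h \<le> K \<Longrightarrow> h + length as \<le> Suc H \<Longrightarrow> \<not> agree_late \<theta> h as \<Longrightarrow>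
    consistent \<theta> (\<not> agree_early \<theta> h as) h Junk as"
proof (induction as arbitrary: h)
  case (Cons a as)
  show ?case
  proof (cases "h = K")
    case True
    then show ?thesis
      using Cons.prems K_less
      by (auto simp: consistent_Dead agree_early_late consistent_Junk_late)
  next
    case False
    then show ?thesis
      using Cons.prems K_less Cons.IH[of "Suc h"] by (auto simp: consistent_Free)
  qed
qed simp

text \<open>In the layers \<open>2, ..., K\<close> the four classes are equally likely and make the
  coin fair. In layer 1 all states are Good and after \<open>K\<close> nearly all are Dead, so there
  the ideal reward is 0.\<close>

definition ideal_round ::
  "((nat, nat) traj \<Rightarrow> nat \<Rightarrow> nat) \<Rightarrow> nat \<Rightarrow> (nat, nat) traj pmf" where
  "ideal_round \<sigma> h =
     bind_pmf (if 1 < h \<and> h \<le> K then pmf_of_set UNIV else return_pmf False)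
       (\<lambda>b. bind_pmf (pmf_of_set (X h)) (rollout_from (ideal b) \<sigma> h))"

definition real_round ::
  "nat set \<Rightarrow> (nat \<times> nat \<Rightarrow> nat) \<Rightarrow> ((nat, nat) traj \<Rightarrow> nat \<Rightarrow> nat) \<Rightarrow> nat \<Rightarrow> (nat, nat) traj pmf" where
  "real_round \<theta> \<omega> \<sigma> h = bind_pmf (pmf_of_set (X h)) (rollout_from (mdp_of \<theta> \<omega>) \<sigma> h)"

definition touched :: "(nat, nat) traj \<Rightarrow> (nat \<times> nat) set" where
  "touched \<tau> = (blk \<circ> fst) ` set \<tau>"

text \<open>The actions reveal the first half of \<open>\<theta>\<close> to a Good state, or open the lock.\<close>

definition hit :: "nat set \<Rightarrow> nat \<Rightarrow> (nat, nat) traj \<Rightarrow> bool" where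
  "hit \<theta> h \<tau> \<longleftrightarrow> h = 1 \<and> agree_early \<theta> h (acts \<tau>) \<or> h \<le> K \<and> agree_late \<theta> h (acts \<tau>)"

lemma rollout_ideal_shape:
  assumes "x \<in> X h" "\<tau> \<in> set_pmf (rollout (ideal b) \<sigma> k \<tau>0 x)"
  shows "\<exists>\<tau>1. \<tau> = \<tau>0 @ \<tau>1 \<and> map (lay \<circ> fst) \<tau>1 = [h..<h + k]"
  using assms
proof (induction k arbitrary: x h \<tau>0)
  case (Suc k)
  then obtain y r where "y \<in> X (Suc h)"
    "\<tau> \<in> set_pmf (rollout (ideal b) \<sigma> k (\<tau>0 @ [(x, \<sigma> \<tau>0 x, r)]) y)"
    by (auto simp: rollout.simps(2) ideal_def Let_def bind_return_pmf)
  from Suc.IH[OF this] obtain \<tau>1 where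
    "\<tau> = \<tau>0 @ (x, \<sigma> \<tau>0 x, r) # \<tau>1" "map (lay \<circ> fst) \<tau>1 = [Suc h..<Suc h + k]"
    by (metis append.assoc append_Cons append_Nil)
  moreover have "[h..<h + Suc k] = h # [Suc h..<Suc h + k]"
    by (simp add: upt_conv_Cons del: upt_Suc)
  ultimately show ?case using Suc.prems(1) by (intro exI[of _ "(x, \<sigma> \<tau>0 x, r) # \<tau>1"]) (simp add: o_def del: upt_Suc)
qed simp

lemma ideal_round_shape:
  assumes "\<tau> \<in> set_pmf (ideal_round \<sigma> h)" "h \<le> H"
  shows "map (lay \<circ> fst) \<tau> = [h..<Suc H]"
proof -
  obtain b x where "x \<in> X h" "\<tau> \<in> set_pmf (rollout (ideal b) \<sigma> (Suc H - h) [] x)"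
    using assms(1) by (auto simp: ideal_round_def rollout_from_def)
  from rollout_ideal_shape[OF this] show ?thesis using assms(2) by simp
qed

text \<open>\<open>rollout_lower\<close> summed over the reset state and over initial classes: class
  \<open>c\<close> has weight \<open>frac h c\<close> and imitates the coin \<open>b c\<close>.
  Classes outside \<open>C\<close> are dropped, which only lowers the bound.\<close>

lemma real_round_lower_aux:
  assumes h: "1 \<le> h" "h \<le> H" and g: "\<And>\<omega>. 0 \<le> g \<omega>"
    and ins: "\<And>i. i \<in> touched \<tau> \<Longrightarrow> insens g i" "\<And>j. insens g (Suc H, j)"
    and dist: "distinct (map (blk \<circ> fst) \<tau>)"
    and C: "finite C" "\<And>c. c \<in> C \<Longrightarrow> valid h c"
      "\<And>c. c \<in> C \<Longrightarrow> consistent \<theta> (b c) h c (acts \<tau>)"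
  shows "(\<Sum>c\<in>C. frac h c * pmf (bind_pmf (pmf_of_set (X h)) (rollout_from (ideal (b c)) \<sigma> h)) \<tau>)
      * measure_pmf.expectation prior g
    \<le> measure_pmf.expectation prior (\<lambda>\<omega>. pmf (real_round \<theta> \<omega> \<sigma> h) \<tau> * g \<omega>)"
proof -
  let ?E = "measure_pmf.expectation prior" and ?k = "Suc H - h" and ?N = "real (n * S)"
  let ?P = "\<lambda>\<omega> x. pmf (rollout (mdp_of \<theta> \<omega>) \<sigma> ?k [] x) \<tau> * g \<omega>"
  have "(\<Sum>c\<in>C. frac h c * pmf (bind_pmf (pmf_of_set (X h)) (rollout_from (ideal (b c)) \<sigma> h)) \<tau>)
      * ?E g
    = (\<Sum>c\<in>C. \<Sum>x\<in>X h. frac h c * pmf (rollout (ideal (b c)) \<sigma> ?k [] x) \<tau> * ?E g) / ?N"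
    by (simp add: pmf_bind_pmf_of_set rollout_from_def card_X sum_divide_distrib
        sum_distrib_left sum_distrib_right)
  also have "\<dots> \<le> (\<Sum>c\<in>C. \<Sum>x\<in>X h. ?E (\<lambda>\<omega>. of_bool (clss \<omega> x = c) * ?P \<omega> x)) / ?N"
    using assms by (intro divide_right_mono sum_mono rollout_lower) (auto simp: touched_def)
  also have "\<dots> = ?E (\<lambda>\<omega>. (\<Sum>c\<in>C. \<Sum>x\<in>X h. of_bool (clss \<omega> x = c) * ?P \<omega> x) / ?N)"
    by (simp only: integral_divide_zero Bochner_Integration.integral_sum integrable_prior)
  also have "\<dots> \<le> ?E (\<lambda>\<omega>. pmf (real_round \<theta> \<omega> \<sigma> h) \<tau> * g \<omega>)"
  proof (rule integral_mono)
    fix \<omega>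
    \<comment> \<open>A state has only one class, so for each \<open>x\<close> at most one summand
      over \<open>C\<close> survives.\<close>
    have "(\<Sum>c\<in>C. \<Sum>x\<in>X h. of_bool (clss \<omega> x = c) * ?P \<omega> x)
      = (\<Sum>x\<in>X h. (\<Sum>c\<in>C. of_bool (clss \<omega> x = c)) * ?P \<omega> x)"
      by (subst sum.swap) (simp only: sum_distrib_right)
    also have "\<dots> \<le> (\<Sum>x\<in>X h. 1 * ?P \<omega> x)"
      using g by (intro sum_mono mult_right_mono sum_of_bool_eq_le_1 C) auto
    finally have "(\<Sum>c\<in>C. \<Sum>x\<in>X h. of_bool (clss \<omega> x = c) * ?P \<omega> x) / ?N
      \<le> (\<Sum>x\<in>X h. 1 * ?P \<omega> x) / ?N"
      by (rule divide_right_mono) simp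
    also have "\<dots> = pmf (real_round \<theta> \<omega> \<sigma> h) \<tau> * g \<omega>"
      by (simp add: real_round_def pmf_bind_pmf_of_set rollout_from_def card_X sum_distrib_right)
    finally show "(\<Sum>c\<in>C. \<Sum>x\<in>X h. of_bool (clss \<omega> x = c) * ?P \<omega> x) / ?N
      \<le> pmf (real_round \<theta> \<omega> \<sigma> h) \<tau> * g \<omega>" .
  qed simp_all
  finally show ?thesis .
qed

text \<open>The factor \<open>1 - 1 / S\<close> is lost only after a reset beyond \<open>K\<close>,
  where the lock is dropped and Dead alone is kept. In the other layers the classes reproduce the
  ideal round with full weight.\<close>

lemma real_round_lower:
  assumes h: "1 \<le> h" "h \<le> H" and g: "\<And>\<omega>. 0 \<le> g \<omega>"
    and ins: "\<And>i. i \<in> touched \<tau> \<Longrightarrow> insens g i" "\<And>j. insens g (Suc H, j)"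
    and hit: "\<not> hit \<theta> h \<tau>"
  shows "(1 - 1 / real S) * pmf (ideal_round \<sigma> h) \<tau> * measure_pmf.expectation prior g
    \<le> measure_pmf.expectation prior (\<lambda>\<omega>. pmf (real_round \<theta> \<omega> \<sigma> h) \<tau> * g \<omega>)"
proof (cases "\<tau> \<in> set_pmf (ideal_round \<sigma> h)")
  case False
  then have "pmf (ideal_round \<sigma> h) \<tau> = 0" by (simp add: set_pmf_iff)
  then show ?thesis using g by (simp add: integral_nonneg)
next
  case True
  let ?E = "measure_pmf.expectation prior"
  have lay: "map (lay \<circ> fst) \<tau> = [h..<Suc H]"
    using ideal_round_shape[OF True h(2)] .
  have len: "h + length (acts \<tau>) \<le> Suc H"
    using arg_cong[OF lay, of length] h by (simp add: acts_def)
  \<comment> \<open>The visited states lie in different layers, hence in different blocks.\<close>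
  have "distinct (map fst (map (blk \<circ> fst) \<tau>))"
    using lay by (simp add: o_def)
  then have dist: "distinct (map (blk \<circ> fst) \<tau>)" using distinct_map by blast
  define J where "J = (\<lambda>b. pmf (bind_pmf (pmf_of_set (X h)) (rollout_from (ideal b) \<sigma> h)) \<tau>)"
  have aux: "(\<Sum>c\<in>C. frac h c * J (b c)) * ?E g
      \<le> ?E (\<lambda>\<omega>. pmf (real_round \<theta> \<omega> \<sigma> h) \<tau> * g \<omega>)"
    if "finite C" "\<And>c. c \<in> C \<Longrightarrow> valid h c" "\<And>c. c \<in> C \<Longrightarrow> consistent \<theta> (b c) h c (acts \<tau>)"
    for C b
    unfolding J_def by (rule real_round_lower_aux[OF h g ins dist that])
  have Eg: "0 \<le> ?E g" using g by (simp add: integral_nonneg)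
  have J: "0 \<le> J b" for b by (simp add: J_def)
  consider "h = 1" | "1 < h" "h \<le> K" | "K < h" using h by linarith
  then show ?thesis
  proof cases
    case 1
    have "consistent \<theta> False h Good (acts \<tau>)"
      using consistent_Good[of h \<theta> "acts \<tau>"] hit 1 K_ge by (simp add: hit_def)
    then have "J False * ?E g \<le> ?E (\<lambda>\<omega>. pmf (real_round \<theta> \<omega> \<sigma> h) \<tau> * g \<omega>)"
      using aux[of "{Good}" "\<lambda>_. False"] 1 by (simp add: valid_def frac_first)
    moreover have "pmf (ideal_round \<sigma> h) \<tau> = J False"
      using 1 by (simp add: ideal_round_def J_def bind_return_pmf)
    moreover have "(1 - 1 / real S) * (J False * ?E g) \<le> 1 * (J False * ?E g)"
      using J Eg by (intro mult_right_mono) auto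
    ultimately show ?thesis by (simp add: mult.assoc)
  next
    case 2
    let ?A = "agree_early \<theta> h (acts \<tau>)"
    \<comment> \<open>Free and Dead are the two constant coins, Good and Junk the opposite ones;
      each coin value thus gets two classes of weight 1/4.\<close>
    let ?b = "\<lambda>c. case c of Good \<Rightarrow> ?A | Junk \<Rightarrow> \<not> ?A | Free \<Rightarrow> True | Dead \<Rightarrow> False"
    have "consistent \<theta> (?b c) h c (acts \<tau>)" for c
      using 2 hit len
      by (cases c) (auto simp only: cls.case hit_def
          intro!: consistent_Good consistent_Junk consistent_Free consistent_Dead)
    then have "(\<Sum>c\<in>UNIV. frac h c * J (?b c)) * ?E g
      \<le> ?E (\<lambda>\<omega>. pmf (real_round \<theta> \<omega> \<sigma> h) \<tau> * g \<omega>)"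
      using 2 by (intro aux) (auto simp: UNIV_cls valid_def)
    moreover have "(\<Sum>c\<in>UNIV. frac h c * J (?b c)) = pmf (ideal_round \<sigma> h) \<tau>"
      using 2 by (cases ?A)
        (simp_all add: UNIV_cls frac_mid ideal_round_def J_def pmf_bind_pmf_of_set UNIV_bool)
    moreover have "(1 - 1 / real S) * (pmf (ideal_round \<sigma> h) \<tau> * ?E g)
        \<le> 1 * (pmf (ideal_round \<sigma> h) \<tau> * ?E g)"
      using Eg by (intro mult_right_mono) auto
    ultimately show ?thesis by (simp add: mult.assoc)
  next
    case 3
    then have "frac h Dead * J False * ?E g \<le> ?E (\<lambda>\<omega>. pmf (real_round \<theta> \<omega> \<sigma> h) \<tau> * g \<omega>)"
      using aux[of "{Dead}" "\<lambda>_. False"] K_ge by (simp add: valid_def consistent_Dead)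
    moreover have "pmf (ideal_round \<sigma> h) \<tau> = J False"
      using 3 by (simp add: ideal_round_def J_def bind_return_pmf)
    ultimately show ?thesis using 3 by (simp add: frac_late_Dead)
  qed
qed

end

section \<open>The interaction as a sequence of rounds\<close>

lemma integrable_indicator_pmf [simp]:
  "integrable (measure_pmf p) (indicator A :: _ \<Rightarrow> real)"
  by (rule measure_pmf.integrable_const_bound[where B = 1]) auto

lemma prob_bind_pmf:
  "measure_pmf.prob (bind_pmf p f) A = measure_pmf.expectation p (\<lambda>x. measure_pmf.prob (f x) A)"
proof -
  have int: "integrable p (\<lambda>x. measure_pmf.prob (f x) A)"
    by (rule measure_pmf.integrable_const_bound[where B = 1]) auto
  have "ennreal (measure_pmf.prob (bind_pmf p f) A) = (\<integral>\<^sup>+x. ennreal (measure_pmf.prob (f x) A) \<partial>p)"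
    by (simp add: measure_pmf.emeasure_eq_measure flip: measure_pmf.emeasure_eq_measure)
  also have "\<dots> = ennreal (measure_pmf.expectation p (\<lambda>x. measure_pmf.prob (f x) A))"
    by (rule nn_integral_eq_integral[OF int]) simp
  finally show ?thesis by (simp add: integral_nonneg)
qed

lemma prob_bind_pmf_le:
  assumes "\<And>x. x \<in> set_pmf p \<Longrightarrow> x \<notin> B \<Longrightarrow> measure_pmf.prob (f x) A \<le> e" and "0 \<le> e"
  shows "measure_pmf.prob (bind_pmf p f) A \<le> measure_pmf.prob p B + e"
proof -
  have "measure_pmf.prob (bind_pmf p f) A = measure_pmf.expectation p (\<lambda>x. measure_pmf.prob (f x) A)"
    by (rule prob_bind_pmf)
  also have "\<dots> \<le> measure_pmf.expectation p (\<lambda>x. indicator B x + e)"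
  proof (rule integral_mono_AE)
    show "integrable p (\<lambda>x. measure_pmf.prob (f x) A)"
      by (rule measure_pmf.integrable_const_bound[where B = 1]) auto
    show "AE x in p. measure_pmf.prob (f x) A \<le> indicator B x + e"
    proof (simp add: AE_measure_pmf_iff, intro ballI)
      fix x assume "x \<in> set_pmf p"
      then show "measure_pmf.prob (f x) A \<le> indicator B x + e"
        using assms(1)[of x] assms(2)
        by (cases "x \<in> B") (simp_all add: add_increasing2)
    qed
  qed simp
  also have "\<dots> = measure_pmf.prob p B + e" by simp
  finally show ?thesis .
qed

text \<open>\<open>play\<close> with the law of a round as a parameter, so that the real and the
  ideal interaction obey the same recursion.\<close>

primrec game ::
  "(('s, 'a) history \<Rightarrow> nat \<Rightarrow> ('s, 'a) traj pmf) \<Rightarrow> ('s, 'a) algorithm \<Rightarrow> nat \<Rightarrow> ('s, 'a) history pmf"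
where
  "game \<kappa> alg 0 = return_pmf []"
| "game \<kappa> alg (Suc k) =
     bind_pmf (game \<kappa> alg k) (\<lambda>hist.
       case decide alg hist of
         Return \<pi> \<Rightarrow> return_pmf hist
       | Reset h \<Rightarrow> map_pmf (\<lambda>\<tau>. hist @ [(h, \<tau>)]) (\<kappa> hist h))"

lemma play_eq_game:
  "play M \<mu> alg k = game (\<lambda>hist h. bind_pmf (\<mu> h) (rollout_from M (act alg hist) h)) alg k"
  by (induction k) simp_all

definition stopped :: "('s, 'a) algorithm \<Rightarrow> ('s, 'a) history \<Rightarrow> bool" where
  "stopped alg hist \<longleftrightarrow> (\<exists>\<pi>. decide alg hist = Return \<pi>)"

lemma pmf_game_Nil:
  "pmf (game \<kappa> alg (Suc k)) [] = of_bool (stopped alg []) * pmf (game \<kappa> alg k) []"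
proof -
  have "pmf (case decide alg h' of Return \<pi> \<Rightarrow> return_pmf h'
      | Reset h \<Rightarrow> map_pmf (\<lambda>\<tau>. h' @ [(h, \<tau>)]) (\<kappa> h' h)) []
    = of_bool (stopped alg []) * indicator {[]} h'" for h'
  proof -
    have "pmf (map_pmf (\<lambda>\<tau>. h' @ [(h, \<tau>)]) (\<kappa> h' h)) [] = 0" for h
      by (intro pmf_map_outside) auto
    then show ?thesis
      by (auto simp: stopped_def split: decision.split split_indicator)
  qed
  then show ?thesis
    by (simp add: pmf_bind measure_pmf_single)
qed

text \<open>There are two disjoint ways to hold this history: the algorithm had already stopped on
  it, or its prefix was extended by one more round.\<close>

lemma pmf_game_snoc:
  "pmf (game \<kappa> alg (Suc k)) (hs @ [(h, \<tau>)]) =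
    of_bool (stopped alg (hs @ [(h, \<tau>)])) * pmf (game \<kappa> alg k) (hs @ [(h, \<tau>)]) +
    of_bool (decide alg hs = Reset h) * (pmf (game \<kappa> alg k) hs * pmf (\<kappa> hs h) \<tau>)"
proof -
  let ?H = "hs @ [(h, \<tau>)]"
  have "pmf (case decide alg h' of Return \<pi> \<Rightarrow> return_pmf h'
      | Reset h \<Rightarrow> map_pmf (\<lambda>\<tau>. h' @ [(h, \<tau>)]) (\<kappa> h' h)) ?H
    = of_bool (stopped alg ?H) * indicator {?H} h'
      + of_bool (decide alg hs = Reset h) * pmf (\<kappa> hs h) \<tau> * indicator {hs} h'" for h'
  proof (cases "decide alg h'")
    case (Return \<pi>)
    then show ?thesis by (auto simp: stopped_def split: split_indicator)
  next
    case (Reset h'')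
    show ?thesis
    proof (cases "h' = hs \<and> h'' = h")
      case True
      have "pmf (map_pmf (\<lambda>\<tau>. hs @ [(h, \<tau>)]) (\<kappa> hs h)) ?H = pmf (\<kappa> hs h) \<tau>"
        by (intro pmf_map_inj'[where f = "\<lambda>\<tau>. hs @ [(h, \<tau>)]"]) (auto simp: inj_def)
      then show ?thesis using True Reset by (auto simp: stopped_def)
    next
      case False
      have "pmf (map_pmf (\<lambda>\<tau>. h' @ [(h'', \<tau>)]) (\<kappa> h' h'')) ?H = 0"
        by (intro pmf_map_outside) (use False in auto)
      then show ?thesis using False Reset by (auto simp: stopped_def split: split_indicator)
    qed
  qed
  then have "pmf (game \<kappa> alg (Suc k)) ?H = measure_pmf.expectation (game \<kappa> alg k)
    (\<lambda>h'. of_bool (stopped alg ?H) * indicator {?H} h'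
      + of_bool (decide alg hs = Reset h) * pmf (\<kappa> hs h) \<tau> * indicator {hs} h')"
    by (simp only: game.simps pmf_bind)
  also have "\<dots> = of_bool (stopped alg ?H) * pmf (game \<kappa> alg k) ?H +
    of_bool (decide alg hs = Reset h) * pmf (\<kappa> hs h) \<tau> * pmf (game \<kappa> alg k) hs"
    by (subst Bochner_Integration.integral_add) (auto simp: measure_pmf_single)
  finally show ?thesis by simp
qed

section \<open>Comparison of whole histories\<close>

context hard_family begin

definition real_game :: "nat set \<Rightarrow> (nat \<times> nat \<Rightarrow> nat) \<Rightarrow> (nat, nat) algorithm \<Rightarrow> nat \<Rightarrow> (nat, nat) history pmf" where
  "real_game \<theta> \<omega> alg = game (\<lambda>hist. real_round \<theta> \<omega> (act alg hist)) alg"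

definition ideal_game :: "(nat, nat) algorithm \<Rightarrow> nat \<Rightarrow> (nat, nat) history pmf" where
  "ideal_game alg = game (\<lambda>hist. ideal_round (act alg hist)) alg"

lemma play_eq_real_game:
  "play (mdp_of \<theta> \<omega>) (\<lambda>h. pmf_of_set (X h)) alg k = real_game \<theta> \<omega> alg k"
proof -
  have "real_round \<theta> \<omega> \<sigma> = (\<lambda>h. bind_pmf (pmf_of_set (X h)) (rollout_from (mdp_of \<theta> \<omega>) \<sigma> h))" for \<sigma>
    by (rule ext) (simp add: real_round_def)
  then show ?thesis by (simp add: play_eq_game real_game_def)
qed

text \<open>On such histories different rounds depend on different, hence independent,
  shifts.\<close>

definition fresh :: "(nat, nat) history \<Rightarrow> bool" where
  "fresh = sorted_wrt (\<lambda>r s. touched (snd r) \<inter> touched (snd s) = {})"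

lemma insens_real_round:
  assumes "i \<notin> touched \<tau>" "1 \<le> h"
  shows "insens (\<lambda>\<omega>. pmf (real_round \<theta> \<omega> \<sigma> h) \<tau>) i"
  unfolding insens_def
proof (intro allI)
  fix \<omega> v
  have "i \<notin> (blk \<circ> fst) ` set \<tau>" using assms by (simp add: touched_def)
  note * = insens_rollout[OF this _ assms(2)]
  show "pmf (real_round \<theta> (fun_upd \<omega> i v) \<sigma> h) \<tau> = pmf (real_round \<theta> \<omega> \<sigma> h) \<tau>"
    unfolding real_round_def rollout_from_def mdp_of_simps
      pmf_bind_pmf_of_set[OF X_nonempty finite_X]
    by (intro arg_cong2[where f = "(/)"] sum.cong refl *)
qed

text \<open>The rounds are averaged from the last to the first. The probability of the last round
  becomes part of the weight \<open>g\<close> of the earlier ones, which ignore its blocks by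
  freshness; each round costs one factor \<open>1 - 1 / S\<close>.\<close>

lemma real_game_lower:
  assumes alg: "\<And>hist h. decide alg hist = Reset h \<Longrightarrow> h \<in> {1..H}"
    and "fresh hist" "\<And>h \<tau>. (h, \<tau>) \<in> set hist \<Longrightarrow> \<not> hit \<theta> h \<tau>"
    and "\<And>\<omega>. 0 \<le> g \<omega>"
    and "\<And>h \<tau> i. (h, \<tau>) \<in> set hist \<Longrightarrow> i \<in> touched \<tau> \<Longrightarrow> insens g i"
    and "\<And>j. insens g (Suc H, j)"
  shows "(1 - 1 / real S) ^ k * pmf (ideal_game alg k) hist * measure_pmf.expectation prior g
    \<le> measure_pmf.expectation prior (\<lambda>\<omega>. pmf (real_game \<theta> \<omega> alg k) hist * g \<omega>)"
  using assms(2-)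
proof (induction k arbitrary: hist g)
  case 0
  then show ?case by (simp add: ideal_game_def real_game_def)
next
  case (Suc k)
  let ?E = "measure_pmf.expectation prior" and ?q = "1 - 1 / real S"
  have q: "0 \<le> ?q" "?q \<le> 1" using S_pos by auto
  have Eg: "0 \<le> ?E g" using Suc.prems by (simp add: integral_nonneg)
  \<comment> \<open>A stopped history used up no round, so the bound with exponent \<open>k\<close>
    is weakened to \<open>Suc k\<close>.\<close>
  have stay: "?q ^ Suc k * (of_bool (stopped alg hist) * pmf (ideal_game alg k) hist) * ?E g
    \<le> ?E (\<lambda>\<omega>. of_bool (stopped alg hist) * pmf (real_game \<theta> \<omega> alg k) hist * g \<omega>)"
  proof (cases "stopped alg hist")
    case True
    have "?q ^ Suc k * (pmf (ideal_game alg k) hist * ?E g)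
      \<le> ?q ^ k * (pmf (ideal_game alg k) hist * ?E g)"
      using q Eg by (intro mult_right_mono power_decreasing) auto
    also have "\<dots> \<le> ?E (\<lambda>\<omega>. pmf (real_game \<theta> \<omega> alg k) hist * g \<omega>)"
      using Suc.IH[OF Suc.prems] by (simp add: mult.assoc)
    finally show ?thesis using True by (simp add: mult.assoc)
  qed simp
  show ?case
  proof (cases hist rule: rev_cases)
    case Nil
    then show ?thesis
      using stay by (simp only: ideal_game_def real_game_def pmf_game_Nil)
  next
    case (snoc hs r)
    obtain h \<tau> where r: "r = (h, \<tau>)" by (cases r)
    have hist: "hist = hs @ [(h, \<tau>)]" using snoc r by simp
    have move: "?q ^ Suc k * (of_bool (decide alg hs = Reset h) *
        (pmf (ideal_game alg k) hs * pmf (ideal_round (act alg hs) h) \<tau>)) * ?E g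
      \<le> ?E (\<lambda>\<omega>. of_bool (decide alg hs = Reset h) *
        (pmf (real_game \<theta> \<omega> alg k) hs * pmf (real_round \<theta> \<omega> (act alg hs) h) \<tau>) * g \<omega>)"
    proof (cases "decide alg hs = Reset h \<and> \<tau> \<in> set_pmf (ideal_round (act alg hs) h)")
      case False
      then have "of_bool (decide alg hs = Reset h) * pmf (ideal_round (act alg hs) h) \<tau> = 0"
        by (auto simp: set_pmf_iff)
      then show ?thesis using Suc.prems(3) by (auto simp: integral_nonneg)
    next
      case True
      then have h: "1 \<le> h" "h \<le> H" using alg[of hs h] by auto
      let ?R = "\<lambda>\<omega>. pmf (real_round \<theta> \<omega> (act alg hs) h) \<tau>"
      have "map (lay \<circ> fst) \<tau> = [h..<Suc H]"
        using ideal_round_shape True h by blast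
      then have "(lay \<circ> fst) ` set \<tau> = {h..<Suc H}"
        by (metis set_map set_upt)
      then have "fst ` touched \<tau> = {h..<Suc H}"
        by (simp add: touched_def image_image)
      \<comment> \<open>The recorded layers end at \<open>H\<close>, so the enlarged weight still
        ignores layer \<open>Suc H\<close>.\<close>
      then have nH: "(Suc H, j) \<notin> touched \<tau>" for j by force
      have disj: "touched \<tau>' \<inter> touched \<tau> = {}" if "(h', \<tau>') \<in> set hs" for h' \<tau>'
        using Suc.prems(1) that by (fastforce simp: fresh_def hist sorted_wrt_append)
      have "?q ^ Suc k * (pmf (ideal_game alg k) hs * pmf (ideal_round (act alg hs) h) \<tau>) * ?E g
        = ?q ^ k * pmf (ideal_game alg k) hs *
          (?q * pmf (ideal_round (act alg hs) h) \<tau> * ?E g)"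
        by simp
      also have "\<dots> \<le> ?q ^ k * pmf (ideal_game alg k) hs * ?E (\<lambda>\<omega>. ?R \<omega> * g \<omega>)"
        using q Suc.prems(2,3,5) Suc.prems(4)[of h \<tau>] h
        by (intro mult_left_mono real_round_lower) (auto simp: hist)
      also have "\<dots> \<le> ?E (\<lambda>\<omega>. pmf (real_game \<theta> \<omega> alg k) hs * (?R \<omega> * g \<omega>))"
      proof (rule Suc.IH)
        show "fresh hs" using Suc.prems(1) by (simp add: fresh_def hist sorted_wrt_append)
        show "insens (\<lambda>\<omega>. ?R \<omega> * g \<omega>) i" if "(h', \<tau>') \<in> set hs" "i \<in> touched \<tau>'" for h' \<tau>' i
          using that disj[OF that(1)] Suc.prems(4)[of h' \<tau>' i] h
          by (intro insens_mult insens_real_round) (auto simp: hist)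
        show "insens (\<lambda>\<omega>. ?R \<omega> * g \<omega>) (Suc H, j)" for j
          using nH h Suc.prems(5) by (intro insens_mult insens_real_round) auto
      qed (use Suc.prems in \<open>auto simp: hist\<close>)
      finally show ?thesis using True by (simp add: mult.assoc)
    qed
    have "?q ^ Suc k * pmf (ideal_game alg (Suc k)) hist * ?E g =
      ?q ^ Suc k * (of_bool (stopped alg hist) * pmf (ideal_game alg k) hist) * ?E g +
      ?q ^ Suc k * (of_bool (decide alg hs = Reset h) *
        (pmf (ideal_game alg k) hs * pmf (ideal_round (act alg hs) h) \<tau>)) * ?E g"
      by (simp only: hist ideal_game_def pmf_game_snoc distrib_left distrib_right)
    also have "\<dots> \<le> ?E (\<lambda>\<omega>. of_bool (stopped alg hist) * pmf (real_game \<theta> \<omega> alg k) hist * g \<omega>) +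
      ?E (\<lambda>\<omega>. of_bool (decide alg hs = Reset h) *
        (pmf (real_game \<theta> \<omega> alg k) hs * pmf (real_round \<theta> \<omega> (act alg hs) h) \<tau>) * g \<omega>)"
      by (intro add_mono stay move)
    also have "\<dots> = ?E (\<lambda>\<omega>. of_bool (stopped alg hist) * pmf (real_game \<theta> \<omega> alg k) hist * g \<omega> +
      of_bool (decide alg hs = Reset h) *
        (pmf (real_game \<theta> \<omega> alg k) hs * pmf (real_round \<theta> \<omega> (act alg hs) h) \<tau>) * g \<omega>)"
      by (rule Bochner_Integration.integral_add[symmetric]) (rule integrable_prior)+
    also have "\<dots> = ?E (\<lambda>\<omega>. pmf (real_game \<theta> \<omega> alg (Suc k)) hist * g \<omega>)"
      by (simp only: hist real_game_def pmf_game_snoc distrib_right)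
    finally show ?thesis .
  qed
qed

end

section \<open>Rarity of repeated blocks and of hits\<close>

lemma card_Pow_Int_eq_le:
  assumes "A \<subseteq> {1..H::nat}"
  shows "card {\<theta> \<in> Pow {1..H}. \<theta> \<inter> A = B} \<le> 2 ^ (H - card A)"
proof -
  have "finite A" using assms finite_subset by blast
  have "card {\<theta> \<in> Pow {1..H}. \<theta> \<inter> A = B} \<le> card (Pow ({1..H} - A))"
  proof (rule card_inj_on_le[where f = "\<lambda>\<theta>. \<theta> - A"])
    show "inj_on (\<lambda>\<theta>. \<theta> - A) {\<theta> \<in> Pow {1..H}. \<theta> \<inter> A = B}"
      by (rule inj_onI) blast
  qed auto
  also have "\<dots> = 2 ^ (H - card A)"
    using assms \<open>finite A\<close> by (simp add: card_Pow card_Diff_subset)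
  finally show ?thesis .
qed

lemma finite_set_game:
  assumes "\<And>hist h. finite (set_pmf (\<kappa> hist h))"
  shows "finite (set_pmf (game \<kappa> alg k))"
  by (induction k) (auto simp: assms split: decision.split)

context hard_family begin

text \<open>Each block holds at most \<open>S\<close> of the \<open>n * S\<close> states of a
  layer.\<close>

lemma prob_blk_in_le:
  assumes "finite U"
  shows "measure_pmf.prob (pmf_of_set (X h)) {x. blk x \<in> U} \<le> real (card U) / real n"
proof -
  have "X h \<inter> {x. blk x \<in> U} \<subseteq> (\<lambda>((l, j), s). enc l j s) ` (U \<times> {..<S})"
  proof
    fix x assume x: "x \<in> X h \<inter> {x. blk x \<in> U}"
    have "x = (\<lambda>((l, j), s). enc l j s) (blk x, pos x)"
      using enc_decode[of x] by (simp add: case_prod_unfold)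
    then show "x \<in> (\<lambda>((l, j), s). enc l j s) ` (U \<times> {..<S})"
      using x pos_X by blast
  qed
  then have "card (X h \<inter> {x. blk x \<in> U}) \<le> card (U \<times> {..<S})"
    using assms by (meson card_image_le card_mono finite_SigmaI finite_imageI finite_lessThan le_trans)
  then have "real (card (X h \<inter> {x. blk x \<in> U})) \<le> real (card U) * real S"
    by (simp add: card_cartesian_product flip: of_nat_mult)
  then show ?thesis
    using n_pos S_pos by (simp add: measure_pmf_of_set card_X field_simps)
qed

lemma touched_simps [simp]:
  "touched [] = {}" "touched (\<tau> @ [(x, a, r)]) = insert (blk x) (touched \<tau>)"
  by (auto simp: touched_def)

text \<open>Union bound over the \<open>k\<close> successors, which are uniform on their layers
  whatever the actions are.\<close>

lemma prob_rollout_touched_le: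
  assumes "finite U" "x \<in> X h" "touched \<tau>0 \<inter> U = {}" "blk x \<notin> U"
  shows "measure_pmf.prob (rollout (ideal b) \<sigma> k \<tau>0 x) {\<tau>. touched \<tau> \<inter> U \<noteq> {}}
    \<le> real k * (real (card U) / real n)"
  using assms(2-)
proof (induction k arbitrary: x h \<tau>0)
  case (Suc k)
  let ?e = "real k * (real (card U) / real n)"
  have "rollout (ideal b) \<sigma> (Suc k) \<tau>0 x = bind_pmf (pmf_of_set (X (Suc h)))
    (rollout (ideal b) \<sigma> k (\<tau>0 @ [(x, \<sigma> \<tau>0 x, of_bool (b \<and> h = K))]))"
    using Suc.prems(1) by (simp add: rollout.simps(2) ideal_def Let_def bind_return_pmf)
  moreover have "measure_pmf.prob (bind_pmf (pmf_of_set (X (Suc h)))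
      (rollout (ideal b) \<sigma> k (\<tau>0 @ [(x, \<sigma> \<tau>0 x, of_bool (b \<and> h = K))])))
      {\<tau>. touched \<tau> \<inter> U \<noteq> {}}
    \<le> measure_pmf.prob (pmf_of_set (X (Suc h))) {y. blk y \<in> U} + ?e"
  proof (rule prob_bind_pmf_le)
    fix y assume "y \<in> set_pmf (pmf_of_set (X (Suc h)))" "y \<notin> {y. blk y \<in> U}"
    then show "measure_pmf.prob (rollout (ideal b) \<sigma> k
        (\<tau>0 @ [(x, \<sigma> \<tau>0 x, of_bool (b \<and> h = K))]) y) {\<tau>. touched \<tau> \<inter> U \<noteq> {}} \<le> ?e"
      using Suc.prems by (intro Suc.IH) auto
  qed simp
  ultimately have "measure_pmf.prob (rollout (ideal b) \<sigma> (Suc k) \<tau>0 x) {\<tau>. touched \<tau> \<inter> U \<noteq> {}}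
    \<le> measure_pmf.prob (pmf_of_set (X (Suc h))) {y. blk y \<in> U} + ?e"
    by (simp only:)
  also have "\<dots> \<le> real (card U) / real n + ?e"
    by (intro add_right_mono prob_blk_in_le assms)
  also have "\<dots> = real (Suc k) * (real (card U) / real n)"
    by (simp add: distrib_right add_divide_distrib)
  finally show ?case .
qed simp

lemma prob_ideal_round_touched_le:
  assumes "finite U" "1 \<le> h" "h \<le> H"
  shows "measure_pmf.prob (ideal_round \<sigma> h) {\<tau>. touched \<tau> \<inter> U \<noteq> {}}
    \<le> real (Suc H) * (real (card U) / real n)"
proof -
  let ?A = "{\<tau>. touched \<tau> \<inter> U \<noteq> {}}"
  have *: "measure_pmf.prob (bind_pmf (pmf_of_set (X h)) (rollout_from (ideal b) \<sigma> h)) ?A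
    \<le> real (Suc H) * (real (card U) / real n)" for b
  proof -
    have "measure_pmf.prob (bind_pmf (pmf_of_set (X h)) (rollout_from (ideal b) \<sigma> h)) ?A
      \<le> measure_pmf.prob (pmf_of_set (X h)) {y. blk y \<in> U}
        + real (Suc H - h) * (real (card U) / real n)"
    proof (rule prob_bind_pmf_le)
      fix x assume "x \<in> set_pmf (pmf_of_set (X h))" "x \<notin> {y. blk y \<in> U}"
      then show "measure_pmf.prob (rollout_from (ideal b) \<sigma> h x) ?A
        \<le> real (Suc H - h) * (real (card U) / real n)"
        unfolding rollout_from_def horizon_ideal
        by (intro prob_rollout_touched_le assms(1)) auto
    qed simp
    \<comment> \<open>One draw for the reset state and at most \<open>H\<close> for its successors,
      as \<open>1 \<le> h\<close>.\<close>
    also have "\<dots> \<le> real (card U) / real n + real H * (real (card U) / real n)"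
      using assms by (intro add_mono prob_blk_in_le mult_right_mono) auto
    finally show ?thesis by (simp add: distrib_right add_divide_distrib)
  qed
  \<comment> \<open>The bound holds for both coins, so the exceptional set of coins is
    empty.\<close>
  have "measure_pmf.prob (ideal_round \<sigma> h) ?A
    \<le> measure_pmf.prob (if 1 < h \<and> h \<le> K then pmf_of_set UNIV else return_pmf False) {}
      + real (Suc H) * (real (card U) / real n)"
    unfolding ideal_round_def by (rule prob_bind_pmf_le[OF *]) simp
  then show ?thesis by simp
qed

lemma finite_set_ideal_round: "finite (set_pmf (ideal_round \<sigma> h))"
proof -
  have "finite (set_pmf (rollout (ideal b) \<sigma> k \<tau>0 x))" for b k \<tau>0 x
    by (induction k arbitrary: x \<tau>0)
       (auto simp: rollout.simps(2) ideal_def Let_def bind_return_pmf)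
  then show ?thesis by (auto simp: ideal_round_def rollout_from_def)
qed

lemma ideal_game_shape:
  assumes alg: "\<And>hist h. decide alg hist = Reset h \<Longrightarrow> h \<in> {1..H}"
    and "hist \<in> set_pmf (ideal_game alg k)"
  shows "length hist \<le> k \<and>
    (\<forall>(h, \<tau>)\<in>set hist. 1 \<le> h \<and> h \<le> H \<and> map (lay \<circ> fst) \<tau> = [h..<Suc H])"
  using assms(2)
proof (induction k arbitrary: hist)
  case (Suc k)
  then obtain h' where h': "h' \<in> set_pmf (ideal_game alg k)"
    "hist \<in> set_pmf (case decide alg h' of Return \<pi> \<Rightarrow> return_pmf h'
       | Reset h \<Rightarrow> map_pmf (\<lambda>\<tau>. h' @ [(h, \<tau>)]) (ideal_round (act alg h') h))"
    by (auto simp: ideal_game_def)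
  show ?case
  proof (cases "decide alg h'")
    case (Reset h)
    then obtain \<tau> where \<tau>: "hist = h' @ [(h, \<tau>)]" "\<tau> \<in> set_pmf (ideal_round (act alg h') h)"
      using h'(2) by auto
    moreover have "1 \<le> h" "h \<le> H" using alg[OF Reset] by auto
    ultimately show ?thesis
      using Suc.IH[OF h'(1)] ideal_round_shape[of \<tau> "act alg h'" h]
      by (auto simp: o_def simp del: upt_Suc)
  next
    case (Return \<pi>)
    then show ?thesis using Suc.IH[OF h'(1)] h'(2) by auto
  qed
qed (simp add: ideal_game_def)

lemma card_touched_history_le:
  assumes "length hist \<le> k" "\<And>h \<tau>. (h, \<tau>) \<in> set hist \<Longrightarrow> length \<tau> \<le> H"
  shows "card (\<Union>r\<in>set hist. touched (snd r)) \<le> k * H"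
proof -
  have "card (\<Union>r\<in>set hist. touched (snd r)) \<le> (\<Sum>r\<in>set hist. card (touched (snd r)))"
    by (rule card_UN_le) simp
  also have "\<dots> \<le> (\<Sum>r\<in>set hist. H)"
  proof (rule sum_mono)
    fix r assume "r \<in> set hist"
    then have "length (snd r) \<le> H" using assms(2)[of "fst r" "snd r"] by simp
    moreover have "card (touched (snd r)) \<le> length (snd r)"
      unfolding touched_def by (metis card_image_le card_length finite_set le_trans)
    ultimately show "card (touched (snd r)) \<le> H" by simp
  qed
  also have "\<dots> \<le> k * H"
    using card_length[of hist] assms(1) by (simp add: le_trans)
  finally show ?thesis .
qed

text \<open>Union bound over the rounds: at most \<open>k' * H\<close> blocks were seen before. The
  cap \<open>k'\<close> is separate from \<open>k\<close> so that the cost of a round stays the same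
  throughout the induction.\<close>

lemma prob_not_fresh_le:
  assumes alg: "\<And>hist h. decide alg hist = Reset h \<Longrightarrow> h \<in> {1..H}" and "k \<le> k'"
  shows "measure_pmf.prob (ideal_game alg k) {hist. \<not> fresh hist}
    \<le> real k * (real (Suc H) * (real (k' * H) / real n))"
  using assms(2)
proof (induction k)
  case 0
  then show ?case by (simp add: ideal_game_def fresh_def)
next
  case (Suc k)
  let ?e = "real (Suc H) * (real (k' * H) / real n)"
  have "measure_pmf.prob (ideal_game alg (Suc k)) {hist. \<not> fresh hist}
    \<le> measure_pmf.prob (ideal_game alg k) {hist. \<not> fresh hist} + ?e"
    unfolding ideal_game_def game.simps
  proof (rule prob_bind_pmf_le)
    fix hist
    assume "hist \<in> set_pmf (game (\<lambda>hist. ideal_round (act alg hist)) alg k)"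
    then have hist: "hist \<in> set_pmf (ideal_game alg k)" by (simp add: ideal_game_def)
    assume "hist \<notin> {hist. \<not> fresh hist}"
    then have fr: "fresh hist" by simp
    have shape: "length hist \<le> k \<and>
      (\<forall>(h, \<tau>)\<in>set hist. 1 \<le> h \<and> h \<le> H \<and> map (lay \<circ> fst) \<tau> = [h..<Suc H])"
      using alg hist by (rule ideal_game_shape)
    let ?U = "\<Union>r\<in>set hist. touched (snd r)"
    show "measure_pmf.prob (case decide alg hist of Return \<pi> \<Rightarrow> return_pmf hist
       | Reset h \<Rightarrow> map_pmf (\<lambda>\<tau>. hist @ [(h, \<tau>)]) (ideal_round (act alg hist) h))
        {hist. \<not> fresh hist} \<le> ?e"
    proof (cases "decide alg hist")
      case (Reset h)
      have "{\<tau>. \<not> fresh (hist @ [(h, \<tau>)])} \<subseteq> {\<tau>. touched \<tau> \<inter> ?U \<noteq> {}}"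
        using fr by (fastforce simp: fresh_def sorted_wrt_append)
      then have "measure_pmf.prob (ideal_round (act alg hist) h) {\<tau>. \<not> fresh (hist @ [(h, \<tau>)])}
        \<le> measure_pmf.prob (ideal_round (act alg hist) h) {\<tau>. touched \<tau> \<inter> ?U \<noteq> {}}"
        by (intro measure_pmf.finite_measure_mono) auto
      also have "\<dots> \<le> real (Suc H) * (real (card ?U) / real n)"
        using alg[OF Reset] by (intro prob_ideal_round_touched_le) (auto simp: touched_def)
      also have "\<dots> \<le> ?e"
      proof -
        have "length \<tau> \<le> H" if "(h, \<tau>) \<in> set hist" for h \<tau>
        proof -
          have "1 \<le> h \<and> map (lay \<circ> fst) \<tau> = [h..<Suc H]"
            using shape that by blast
          then have "length \<tau> = Suc H - h" "1 \<le> h" by (metis length_map length_upt, simp)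
          then show ?thesis by simp
        qed
        then have "card ?U \<le> k' * H"
          using shape Suc.prems by (intro card_touched_history_le) auto
        then show ?thesis by (intro mult_left_mono divide_right_mono of_nat_mono) simp_all
      qed
      finally show ?thesis using Reset by (simp add: vimage_def)
    next
      case (Return \<pi>)
      then show ?thesis using fr by simp
    qed
  qed simp
  also have "\<dots> \<le> real k * ?e + ?e" using Suc by simp
  also have "\<dots> = real (Suc k) * ?e"
    by (simp only: of_nat_Suc distrib_right mult_1_left add.commute)
  finally show ?case .
qed

lemma agree_early_nth:
  "agree_early \<theta> h as \<Longrightarrow> i < length as \<Longrightarrow> h + i \<le> K \<Longrightarrow> as ! i = bit_at \<theta> (h + i)"
proof (induction as arbitrary: h i)
  case (Cons a as)
  then show ?case using Cons.IH[of "Suc h" "i - 1"] by (cases i) auto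
qed simp

lemma agree_late_nth:
  "agree_late \<theta> h as \<Longrightarrow> i < length as \<Longrightarrow> K < h + i \<Longrightarrow> as ! i = bit_at \<theta> (h + i)"
proof (induction as arbitrary: h i)
  case (Cons a as)
  then show ?case using Cons.IH[of "Suc h" "i - 1"] by (cases i) auto
qed simp

text \<open>A hit makes the actions of \<open>\<tau>\<close> spell out one half of
  \<open>\<theta>\<close>: the bits \<open>1, ..., K\<close>, or, as the round starts at or before
  \<open>K\<close>, all bits after \<open>K\<close>.\<close>

lemma card_hit_le:
  assumes "1 \<le> h" "h + length \<tau> = Suc H" "2 * K \<le> H"
  shows "card {\<theta> \<in> Pow {1..H}. hit \<theta> h \<tau>} \<le> 2 * 2 ^ (H - K)"
proof -
  let ?as = "acts \<tau>"
  have len: "length ?as = length \<tau>" by (simp add: acts_def)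
  let ?E = "{\<theta> \<in> Pow {1..H}. \<theta> \<inter> {1..K} = {i\<in>{1..K}. ?as ! (i - 1) = 1}}"
  let ?L = "{\<theta> \<in> Pow {1..H}. \<theta> \<inter> {Suc K..H} = {i\<in>{Suc K..H}. ?as ! (i - h) = 1}}"
  have "hit \<theta> h \<tau> \<Longrightarrow> \<theta> \<in> Pow {1..H} \<Longrightarrow> \<theta> \<in> ?E \<union> ?L" for \<theta>
  proof -
    assume th: "\<theta> \<in> Pow {1..H}" and "hit \<theta> h \<tau>"
    then consider "h = 1" "agree_early \<theta> 1 ?as" | "h \<le> K" "agree_late \<theta> h ?as"
      by (auto simp: hit_def)
    then show ?thesis
    proof cases
      case 1
      have "?as ! (i - 1) = bit_at \<theta> i" if "i \<in> {1..K}" for i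
        using agree_early_nth[OF 1(2), of "i - 1"] that assms len 1(1) K_less by auto
      then have "?as ! (i - 1) = 1 \<longleftrightarrow> i \<in> \<theta>" if "i \<in> {1..K}" for i
        using that by (simp add: bit_at_def)
      then show ?thesis using th by (intro UnI1) auto
    next
      case 2
      have "?as ! (i - h) = bit_at \<theta> i" if "i \<in> {Suc K..H}" for i
        using agree_late_nth[OF 2(2), of "i - h"] that assms len 2(1) by auto
      then have "?as ! (i - h) = 1 \<longleftrightarrow> i \<in> \<theta>" if "i \<in> {Suc K..H}" for i
        using that by (simp add: bit_at_def)
      then show ?thesis using th by (intro UnI2) auto
    qed
  qed
  then have "{\<theta> \<in> Pow {1..H}. hit \<theta> h \<tau>} \<subseteq> ?E \<union> ?L" by blast
  then have "card {\<theta> \<in> Pow {1..H}. hit \<theta> h \<tau>} \<le> card (?E \<union> ?L)"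
    by (rule card_mono[rotated]) simp
  also have "\<dots> \<le> card ?E + card ?L" by (rule card_Un_le)
  also have "\<dots> \<le> 2 ^ (H - card {1..K}) + 2 ^ (H - card {Suc K..H})"
    using K_less by (intro add_mono card_Pow_Int_eq_le) auto
  \<comment> \<open>Fixing the second half leaves \<open>2 ^ K\<close> secrets, at most
    \<open>2 ^ (H - K)\<close> by \<open>2 * K \<le> H\<close>.\<close>
  also have "\<dots> \<le> 2 ^ (H - K) + (2::nat) ^ (H - K)"
    using assms by (intro add_mono power_increasing) auto
  finally show ?thesis by simp
qed

end

section \<open>Truncation to finitely many rounds\<close>

lemma prob_Collect_not:
  "measure_pmf.prob p {x. \<not> P x} = 1 - measure_pmf.prob p {x. P x}"
  using measure_pmf.prob_neg[of p P] by simp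

lemma play_running:
  "hist \<in> set_pmf (play M \<mu> alg k) \<Longrightarrow> length hist = k \<or> (\<exists>\<pi>. decide alg hist = Return \<pi>)"
proof (induction k arbitrary: hist)
  case (Suc k)
  then obtain h' where h': "h' \<in> set_pmf (play M \<mu> alg k)"
    "hist \<in> set_pmf (case decide alg h' of Return \<pi> \<Rightarrow> return_pmf h'
       | Reset h \<Rightarrow> map_pmf (\<lambda>\<tau>. h' @ [(h, \<tau>)]) (bind_pmf (\<mu> h) (rollout_from M (act alg h') h)))"
    by auto
  then show ?case using Suc.IH[OF h'(1)]
    by (cases "decide alg h'") auto
qed simp

lemma play_stable:
  assumes "\<And>hist. hist \<in> set_pmf (play M \<mu> alg k) \<Longrightarrow> \<exists>\<pi>. decide alg hist = Return \<pi>" "k \<le> k'"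
  shows "play M \<mu> alg k' = play M \<mu> alg k"
  using assms(2)
proof (induction k' rule: dec_induct)
  case (step k')
  have "play M \<mu> alg (Suc k') = bind_pmf (play M \<mu> alg k') return_pmf"
    unfolding play.simps
  proof (rule bind_pmf_cong[OF refl])
    fix hist assume "hist \<in> set_pmf (play M \<mu> alg k')"
    then obtain \<pi> where "decide alg hist = Return \<pi>" using assms(1) step by metis
    then show "(case decide alg hist of Return \<pi> \<Rightarrow> return_pmf hist
       | Reset h \<Rightarrow> map_pmf (\<lambda>\<tau>. hist @ [(h, \<tau>)]) (bind_pmf (\<mu> h) (rollout_from M (act alg hist) h)))
      = return_pmf hist" by simp
  qed
  then show ?case using step by (simp add: bind_return_pmf')
qed simp

lemma prob_play_mono:
  fixes Q alg defines "E \<equiv> {hist. \<exists>\<pi>. decide alg hist = Return \<pi> \<and> Q \<pi>}"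
  assumes "k \<le> k'"
  shows "measure_pmf.prob (play M \<mu> alg k) E \<le> measure_pmf.prob (play M \<mu> alg k') E"
  using assms(2)
proof (induction k' rule: dec_induct)
  case (step k')
  let ?f = "\<lambda>hist. case decide alg hist of Return \<pi> \<Rightarrow> return_pmf hist
    | Reset h \<Rightarrow> map_pmf (\<lambda>\<tau>. hist @ [(h, \<tau>)]) (bind_pmf (\<mu> h) (rollout_from M (act alg hist) h))"
  have "measure_pmf.prob (play M \<mu> alg k') E = measure_pmf.expectation (play M \<mu> alg k') (indicator E)"
    by simp
  also have "\<dots> \<le> measure_pmf.expectation (play M \<mu> alg k') (\<lambda>hist. measure_pmf.prob (?f hist) E)"
  proof (rule integral_mono)
    show "integrable (play M \<mu> alg k') (\<lambda>hist. measure_pmf.prob (?f hist) E)"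
      by (rule measure_pmf.integrable_const_bound[where B = 1]) auto
    show "indicator E hist \<le> measure_pmf.prob (?f hist) E" for hist
      by (auto simp: E_def split: split_indicator decision.split)
  qed simp
  also have "\<dots> = measure_pmf.prob (play M \<mu> alg (Suc k')) E"
    by (simp only: play.simps prob_bind_pmf)
  finally show ?case using step by simp
qed simp

text \<open>If \<open>T\<close> samples are almost surely never reached, every history after
  \<open>k \<ge> T\<close> rounds has stopped; \<open>play\<close> is constant from then on and the
  supremum is attained at \<open>k\<close>.\<close>

lemma prob_returns_le_prob_play:
  assumes "\<not> 0 < prob_samples_at_least M \<mu> alg T" "T \<le> real k"
  shows "prob_returns M \<mu> alg Q \<le>
    measure_pmf.prob (play M \<mu> alg k) {hist. \<exists>\<pi>. decide alg hist = Return \<pi> \<and> Q \<pi>}"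
proof -
  have "measure_pmf.prob (play M \<mu> alg k) {hist. T \<le> real (length hist)}
    \<le> prob_samples_at_least M \<mu> alg T"
    unfolding prob_samples_at_least_def by (intro cSUP_upper bdd_aboveI[of _ 1]) auto
  then have "measure_pmf.prob (play M \<mu> alg k) {hist. T \<le> real (length hist)} = 0"
    using assms(1) by (smt (verit) measure_nonneg)
  then have "hist \<notin> {hist. T \<le> real (length hist)}" if "hist \<in> set_pmf (play M \<mu> alg k)" for hist
    using that by (auto simp: measure_pmf_zero_iff)
  then have stop: "\<exists>\<pi>. decide alg hist = Return \<pi>" if "hist \<in> set_pmf (play M \<mu> alg k)" for hist
    using play_running[OF that] that assms(2) by auto
  show ?thesis
    unfolding prob_returns_def
  proof (rule cSUP_least)
    fix k' :: nat
    show "measure_pmf.prob (play M \<mu> alg k') {hist. \<exists>\<pi>. decide alg hist = Return \<pi> \<and> Q \<pi>}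
      \<le> measure_pmf.prob (play M \<mu> alg k) {hist. \<exists>\<pi>. decide alg hist = Return \<pi> \<and> Q \<pi>}"
      using prob_play_mono[where k = k' and k' = k and M = M and \<mu> = \<mu> and alg = alg and Q = Q] play_stable[OF stop, where k' = k'] by (cases "k' \<le> k") auto
  qed simp
qed

section \<open>Averaging over the secret\<close>

context hard_family begin

lemma pol_eq_imp: "pol \<theta> = pol \<theta>' \<Longrightarrow> \<theta> \<inter> {1..H} = \<theta>' \<inter> {1..H}"
proof -
  assume eq: "pol \<theta> = pol \<theta>'"
  have "h \<in> \<theta> \<longleftrightarrow> h \<in> \<theta>'" if "h \<in> {1..H}" for h
  proof -
    obtain x where "x \<in> X h" using X_nonempty by blast
    then have "bit_at \<theta> h = bit_at \<theta>' h" using fun_cong[OF eq, of x] that by (simp add: pol_X)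
    then show ?thesis by (simp add: bit_at_def of_bool_eq_iff)
  qed
  then show ?thesis by blast
qed

lemma inj_on_pol: "inj_on pol (Pow {1..H})"
  by (rule inj_onI) (use pol_eq_imp in blast)

text \<open>Follows from 1/8-optimality of a returned member of the class, but does not mention
  \<open>\<omega>\<close>, so it can be evaluated on ideal histories.\<close>

definition succeeds :: "(nat, nat) algorithm \<Rightarrow> nat set \<Rightarrow> (nat, nat) history \<Rightarrow> bool" where
  "succeeds alg \<theta> hist \<longleftrightarrow>
     (\<exists>\<theta>'. decide alg hist = Return (pol \<theta>') \<and> \<theta>' \<inter> {1..K} = \<theta> \<inter> {1..K})"

text \<open>The history determines the returned policy, and success then fixes the first
  \<open>K\<close> bits of \<open>\<theta>\<close>.\<close>

lemma card_succeeds_le: "card {\<theta> \<in> Pow {1..H}. succeeds alg \<theta> hist} \<le> 2 ^ (H - K)"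
proof (cases "\<exists>\<theta>1. decide alg hist = Return (pol \<theta>1)")
  case True
  then obtain \<theta>1 where 1: "decide alg hist = Return (pol \<theta>1)" by blast
  have "\<theta> \<inter> {1..K} = \<theta>1 \<inter> {1..K}" if s: "succeeds alg \<theta> hist" for \<theta>
  proof -
    obtain \<theta>' where "pol \<theta>1 = pol \<theta>'" "\<theta>' \<inter> {1..K} = \<theta> \<inter> {1..K}"
      using s 1 by (auto simp: succeeds_def)
    moreover have "{1..K} \<subseteq> {1..H}" using K_less by auto
    ultimately show ?thesis using pol_eq_imp[of \<theta>1 \<theta>'] by blast
  qed
  then have "{\<theta> \<in> Pow {1..H}. succeeds alg \<theta> hist}
    \<subseteq> {\<theta> \<in> Pow {1..H}. \<theta> \<inter> {1..K} = \<theta>1 \<inter> {1..K}}" by blast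
  then have "card {\<theta> \<in> Pow {1..H}. succeeds alg \<theta> hist}
    \<le> card {\<theta> \<in> Pow {1..H}. \<theta> \<inter> {1..K} = \<theta>1 \<inter> {1..K}}"
    by (rule card_mono[rotated]) simp
  also have "\<dots> \<le> 2 ^ (H - card {1..K})"
    using K_less by (intro card_Pow_Int_eq_le) auto
  finally show ?thesis by simp
next
  case False
  then show ?thesis by (auto simp: succeeds_def)
qed

text \<open>Double counting of pairs of a secret and a fresh history. The factors are the loss of
  \<open>real_game_lower\<close>, the share of secrets that a history neither hits nor guesses, and
  the ideal probability of a fresh history.\<close>

lemma average_failure_lower:
  assumes KH: "2 * K \<le> H" and k: "2 * k + 1 \<le> 2 ^ K"
    and alg: "\<And>hist h. decide alg hist = Reset h \<Longrightarrow> h \<in> {1..H}"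
    and fail: "\<And>\<theta> \<omega>. \<theta> \<in> Pow {1..H} \<Longrightarrow>
      measure_pmf.prob (real_game \<theta> \<omega> alg k) {hist. \<not> succeeds alg \<theta> hist} \<le> r"
  shows "(1 - 1 / real S) ^ k * (1 - real (2 * k + 1) / 2 ^ K) *
    (1 - real k * (real (Suc H) * (real (k * H) / real n))) \<le> r"
proof -
  let ?\<Theta> = "Pow {1..H}" and ?E = "measure_pmf.expectation prior" and ?q = "1 - 1 / real S"
  let ?P = "ideal_game alg k"
  have q: "0 \<le> ?q" using S_pos by simp
  define A where "A = {hist \<in> set_pmf ?P. fresh hist}"
  define miss where "miss = (\<lambda>\<theta> hist. (\<forall>(h, \<tau>)\<in>set hist. \<not> hit \<theta> h \<tau>) \<and> \<not> succeeds alg \<theta> hist)"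
  have finA: "finite A"
    unfolding A_def ideal_game_def by (simp add: finite_set_game finite_set_ideal_round)
  \<comment> \<open>For one secret: \<open>real_game_lower\<close> with weight 1 is summed over
    histories, and \<open>fail\<close> is averaged over the prior.\<close>
  have one: "?q ^ k * (\<Sum>hist\<in>A. of_bool (miss \<theta> hist) * pmf ?P hist) \<le> r"
    if \<theta>: "\<theta> \<in> ?\<Theta>" for \<theta>
  proof -
    let ?A = "{hist \<in> A. miss \<theta> hist}"
    have "?q ^ k * (\<Sum>hist\<in>A. of_bool (miss \<theta> hist) * pmf ?P hist)
      = (\<Sum>hist\<in>?A. ?q ^ k * pmf ?P hist * ?E (\<lambda>_. 1))"
      using finA by (simp add: sum_distrib_left Int_def of_bool_def if_distrib if_distribR
          sum.If_cases mult_ac cong: if_cong)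
    also have "\<dots> \<le> (\<Sum>hist\<in>?A. ?E (\<lambda>\<omega>. pmf (real_game \<theta> \<omega> alg k) hist * 1))"
      using alg by (intro sum_mono real_game_lower) (auto simp: A_def miss_def insens_def)
    also have "\<dots> = ?E (\<lambda>\<omega>. measure_pmf.prob (real_game \<theta> \<omega> alg k) ?A)"
      using finA by (simp add: measure_measure_pmf_finite Bochner_Integration.integral_sum)
    also have "\<dots> \<le> ?E (\<lambda>_. r)"
    proof (rule integral_mono)
      fix \<omega>
      have "measure_pmf.prob (real_game \<theta> \<omega> alg k) ?A
        \<le> measure_pmf.prob (real_game \<theta> \<omega> alg k) {hist. \<not> succeeds alg \<theta> hist}"
        by (intro measure_pmf.finite_measure_mono) (auto simp: miss_def)
      then show "measure_pmf.prob (real_game \<theta> \<omega> alg k) ?A \<le> r"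
        using fail[OF \<theta>, of \<omega>] by simp
    qed simp_all
    finally show ?thesis by simp
  qed
  \<comment> \<open>For one history: each of at most \<open>k\<close> rounds excludes
    \<open>2 * 2 ^ (H - K)\<close> secrets, and the returned policy \<open>2 ^ (H - K)\<close>
    more.\<close>
  have many: "2 ^ H * (1 - real (2 * k + 1) / 2 ^ K) \<le> (\<Sum>\<theta>\<in>?\<Theta>. of_bool (miss \<theta> hist))"
    if hist: "hist \<in> A" for hist
  proof -
    have "hist \<in> set_pmf ?P" using hist by (simp add: A_def)
    with alg have shape: "length hist \<le> k \<and>
      (\<forall>(h, \<tau>)\<in>set hist. 1 \<le> h \<and> h \<le> H \<and> map (lay \<circ> fst) \<tau> = [h..<Suc H])"
      by (rule ideal_game_shape)
    let ?B = "\<Union>r\<in>set hist. {\<theta> \<in> ?\<Theta>. hit \<theta> (fst r) (snd r)}"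
    let ?C = "{\<theta> \<in> ?\<Theta>. succeeds alg \<theta> hist}"
    have "card ?B \<le> (\<Sum>r\<in>set hist. card {\<theta> \<in> ?\<Theta>. hit \<theta> (fst r) (snd r)})"
      by (rule card_UN_le) simp
    also have "\<dots> \<le> (\<Sum>r\<in>set hist. 2 * 2 ^ (H - K))"
    proof (rule sum_mono)
      fix r assume "r \<in> set hist"
      then have r: "1 \<le> fst r" "fst r \<le> H" "map (lay \<circ> fst) (snd r) = [fst r..<Suc H]"
        using shape by (auto simp: case_prod_unfold simp del: upt_Suc)
      from r(3) have "length (snd r) = Suc H - fst r" by (metis length_map length_upt)
      then show "card {\<theta> \<in> ?\<Theta>. hit \<theta> (fst r) (snd r)} \<le> 2 * 2 ^ (H - K)"
        using r KH by (intro card_hit_le) auto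
    qed
    also have "\<dots> = card (set hist) * (2 * 2 ^ (H - K))" by simp
    also have "\<dots> \<le> k * (2 * 2 ^ (H - K))"
      using shape card_length[of hist] by (intro mult_right_mono) auto
    finally have B: "card ?B \<le> k * (2 * 2 ^ (H - K))" .
    have "card ?\<Theta> \<le> card ({\<theta> \<in> ?\<Theta>. miss \<theta> hist} \<union> (?B \<union> ?C))"
      by (rule card_mono) (auto simp: miss_def)
    also have "\<dots> \<le> card {\<theta> \<in> ?\<Theta>. miss \<theta> hist} + card (?B \<union> ?C)" by (rule card_Un_le)
    also have "card (?B \<union> ?C) \<le> card ?B + card ?C" by (rule card_Un_le)
    also have "card ?B + card ?C \<le> k * (2 * 2 ^ (H - K)) + 2 ^ (H - K)"
      by (intro add_mono B card_succeeds_le)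
    finally have "2 ^ H \<le> card {\<theta> \<in> ?\<Theta>. miss \<theta> hist} + (2 * k + 1) * 2 ^ (H - K)"
      by (simp add: card_Pow algebra_simps)
    then have "real (2 ^ H) \<le> real (card {\<theta> \<in> ?\<Theta>. miss \<theta> hist} + (2 * k + 1) * 2 ^ (H - K))"
      by (rule of_nat_mono)
    then have "2 ^ H \<le> real (card {\<theta> \<in> ?\<Theta>. miss \<theta> hist}) + real (2 * k + 1) * 2 ^ (H - K)"
      by (simp add: algebra_simps)
    moreover have "(2::real) ^ (H - K) = 2 ^ H / 2 ^ K"
      using K_less by (simp add: power_diff)
    moreover have "(\<Sum>\<theta>\<in>?\<Theta>. of_bool (miss \<theta> hist)) = real (card {\<theta> \<in> ?\<Theta>. miss \<theta> hist})"
      by (simp add: Int_def)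
    ultimately show ?thesis by (simp add: algebra_simps)
  qed
  have b: "0 \<le> 1 - real (2 * k + 1) / 2 ^ K"
  proof -
    have "real (2 * k + 1) \<le> real (2 ^ K)" using k by (rule of_nat_mono)
    then show ?thesis by simp
  qed
  have pA: "1 - real k * (real (Suc H) * (real (k * H) / real n)) \<le> (\<Sum>hist\<in>A. pmf ?P hist)"
  proof -
    have "measure_pmf.prob ?P {hist. \<not> fresh hist}
        \<le> real k * (real (Suc H) * (real (k * H) / real n))"
      by (intro prob_not_fresh_le alg order_refl)
    moreover have "measure_pmf.prob ?P {hist. \<not> fresh hist} = 1 - measure_pmf.prob ?P {hist. fresh hist}"
      by (rule prob_Collect_not)
    moreover have "measure_pmf.prob ?P {hist. fresh hist} = measure_pmf.prob ?P A"
      by (rule measure_pmf.finite_measure_eq_AE) (auto simp: A_def AE_measure_pmf_iff)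
    moreover have "measure_pmf.prob ?P A = (\<Sum>hist\<in>A. pmf ?P hist)"
      using finA by (rule measure_measure_pmf_finite)
    ultimately show ?thesis by linarith
  qed
  \<comment> \<open>Everything is summed over the \<open>2 ^ H\<close> secrets: \<open>many\<close>
    applies to each history, then the sums are exchanged and \<open>one\<close> applies to each
    secret.\<close>
  have "2 ^ H * (?q ^ k * (1 - real (2 * k + 1) / 2 ^ K) *
      (1 - real k * (real (Suc H) * (real (k * H) / real n))))
    \<le> 2 ^ H * (?q ^ k * (1 - real (2 * k + 1) / 2 ^ K) * (\<Sum>hist\<in>A. pmf ?P hist))"
    using q b pA by (intro mult_left_mono mult_nonneg_nonneg) auto
  also have "\<dots> = ?q ^ k * (\<Sum>hist\<in>A. (2 ^ H * (1 - real (2 * k + 1) / 2 ^ K)) * pmf ?P hist)"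
    unfolding sum_distrib_left[symmetric] by (simp only: mult_ac)
  also have "\<dots> \<le> ?q ^ k * (\<Sum>hist\<in>A. (\<Sum>\<theta>\<in>?\<Theta>. of_bool (miss \<theta> hist)) * pmf ?P hist)"
    using q many by (intro mult_left_mono sum_mono mult_right_mono) auto
  also have "\<dots> = (\<Sum>\<theta>\<in>?\<Theta>. ?q ^ k * (\<Sum>hist\<in>A. of_bool (miss \<theta> hist) * pmf ?P hist))"
    unfolding sum_distrib_left[symmetric] sum_distrib_right by (subst sum.swap) (rule refl)
  also have "\<dots> \<le> (\<Sum>\<theta>\<in>?\<Theta>. r)"
    by (intro sum_mono one)
  also have "\<dots> = 2 ^ H * r"
    by (simp add: card_Pow)
  finally show ?thesis by simp
qed

text \<open>If no instance reached \<open>T\<close> samples, \<open>k\<close> rounds would suffice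
  everywhere and fail with probability at most \<open>1 - p\<close> for all secrets and shifts,
  against \<open>average_failure_lower\<close>.\<close>

lemma many_samples:
  assumes KH: "2 * K \<le> H" and k: "2 * k + 1 \<le> 2 ^ K" "T \<le> real k"
    and alg: "proper_algorithm H {0, 1} (pol ` Pow {1..H}) alg"
    and succ: "\<And>\<theta> \<omega>. \<theta> \<in> Pow {1..H} \<Longrightarrow>
      p \<le> prob_returns (mdp_of \<theta> \<omega>) (\<lambda>h. pmf_of_set (X h)) alg
            (eps_optimal (pol ` Pow {1..H}) (mdp_of \<theta> \<omega>) (1/8))"
    and large: "1 - p < (1 - 1 / real S) ^ k * (1 - real (2 * k + 1) / 2 ^ K) *
      (1 - real k * (real (Suc H) * (real (k * H) / real n)))"
  shows "\<exists>\<theta>\<in>Pow {1..H}. \<exists>\<omega>.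
    0 < prob_samples_at_least (mdp_of \<theta> \<omega>) (\<lambda>h. pmf_of_set (X h)) alg T"
proof (rule ccontr)
  assume few: "\<not> ?thesis"
  have dec: "case decide alg hist of Reset h \<Rightarrow> h \<in> {1..H} | Return \<pi> \<Rightarrow> \<pi> \<in> pol ` Pow {1..H}" for hist
    using alg unfolding proper_algorithm_def by blast
  have "(1 - 1 / real S) ^ k * (1 - real (2 * k + 1) / 2 ^ K) *
      (1 - real k * (real (Suc H) * (real (k * H) / real n))) \<le> 1 - p"
  proof (rule average_failure_lower[OF KH k(1)])
    fix hist h assume "decide alg hist = Reset h"
    then show "h \<in> {1..H}" using dec[of hist] by simp
  next
    fix \<theta> \<omega> assume \<theta>: "\<theta> \<in> Pow {1..H}"
    let ?M = "mdp_of \<theta> \<omega>" and ?\<mu> = "\<lambda>h. pmf_of_set (X h)"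
    let ?O = "eps_optimal (pol ` Pow {1..H}) ?M (1/8)"
    have "\<not> 0 < prob_samples_at_least ?M ?\<mu> alg T" using few \<theta> by blast
    from prob_returns_le_prob_play[OF this k(2), of ?O] succ[OF \<theta>, of \<omega>]
    have "p \<le> measure_pmf.prob (play ?M ?\<mu> alg k) {hist. \<exists>\<pi>. decide alg hist = Return \<pi> \<and> ?O \<pi>}"
      by linarith
    also have "\<dots> \<le> measure_pmf.prob (play ?M ?\<mu> alg k) {hist. succeeds alg \<theta> hist}"
    proof (intro measure_pmf.finite_measure_mono subsetI)
      fix hist assume "hist \<in> {hist. \<exists>\<pi>. decide alg hist = Return \<pi> \<and> ?O \<pi>}"
      then obtain \<pi> where \<pi>: "decide alg hist = Return \<pi>" "?O \<pi>" by blast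
      then obtain \<theta>' where "\<pi> = pol \<theta>'" using dec[of hist] by auto
      with \<pi> show "hist \<in> {hist. succeeds alg \<theta> hist}"
        using eps_optimal_pol_agrees[OF \<theta>] by (auto simp: succeeds_def)
    qed simp
    also have "\<dots> = 1 - measure_pmf.prob (play ?M ?\<mu> alg k) {hist. \<not> succeeds alg \<theta> hist}"
      by (simp add: prob_Collect_not)
    finally show "measure_pmf.prob (real_game \<theta> \<omega> alg k) {hist. \<not> succeeds alg \<theta> hist} \<le> 1 - p"
      by (simp add: play_eq_real_game)
  qed
  then show False using large by simp
qed

end

section \<open>Asymptotics of the parameters\<close>

lemma hard_parameters:
  fixes p :: real
  assumes "0 < p" "p < 1"
  obtains H0 :: nat where
    "\<And>H K k. H0 \<le> H \<Longrightarrow> K = H div 2 \<Longrightarrow> k = nat \<lceil>2 powr (1 / 8 * real H)\<rceil> \<Longrightarrow>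
      2 * k + 1 \<le> 2 ^ K \<and>
      1 - p < (1 - 1 / real (4 * 2 ^ H)) ^ k * (1 - real (2 * k + 1) / 2 ^ K) *
        (1 - real k * (real (Suc H) * (real (k * H) / real (2 ^ H))))"
proof -
  let ?T = "\<lambda>H::nat. 2 powr (1 / 8 * real H)"
  \<comment> \<open>Smooth bounds on the three losses: the rounded \<open>k\<close> is at most
    \<open>?T H + 1\<close>, and \<open>H div 2\<close> is at least
    \<open>H / 2 - 1\<close>.\<close>
  let ?a = "\<lambda>H. (?T H + 1) / (4 * 2 powr real H)"
  let ?b = "\<lambda>H. (2 * (?T H + 1) + 1) / 2 powr (real H / 2 - 1)"
  let ?d = "\<lambda>H. (?T H + 1) * ((real H + 1) * ((?T H + 1) * real H / 2 powr real H))"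
  have "(\<lambda>H. ?a H + ?b H + ?d H) \<longlonglongrightarrow> 0"
    \<comment> \<open>Up to polynomial factors the exponents of 2 are \<open>- 7 / 8 * H\<close>,
      \<open>- 3 / 8 * H\<close> and \<open>- 3 / 4 * H\<close>.\<close>
    by real_asymp
  then have "eventually (\<lambda>H. ?a H + ?b H + ?d H < p) sequentially"
    using assms(1) by (rule order_tendstoD(2))
  then obtain H0 where H0: "\<And>H. H0 \<le> H \<Longrightarrow> ?a H + ?b H + ?d H < p"
    by (auto simp: eventually_sequentially)
  show ?thesis
  proof (rule that)
    fix H K k :: nat
    assume H: "H0 \<le> H" and K: "K = H div 2" and k: "k = nat \<lceil>?T H\<rceil>"
    have kT: "real k \<le> ?T H + 1"
      unfolding k using of_int_ceiling_le_add_one[of "?T H"] by simp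
    have pH: "2 powr real H = 2 ^ H" by (simp add: powr_realpow)
    have "real H \<le> real (2 * K + 1)" unfolding K by (rule of_nat_mono) simp
    then have "2 powr (real H / 2 - 1) \<le> 2 powr real K"
      by (intro powr_mono) auto
    then have pK: "2 powr (real H / 2 - 1) \<le> 2 ^ K" by (simp add: powr_realpow)
    have a: "real k * (1 / (4 * 2 ^ H)) \<le> ?a H"
      using kT by (simp add: pH divide_right_mono)
    have "real (2 * k + 1) / 2 ^ K \<le> (2 * (?T H + 1) + 1) / 2 ^ K"
      using kT by (intro divide_right_mono) auto
    also have "\<dots> \<le> ?b H"
      using pK by (intro divide_left_mono) auto
    finally have b: "real (2 * k + 1) / 2 ^ K \<le> ?b H" .
    have d: "real k * (real (Suc H) * (real (k * H) / real (2 ^ H))) \<le> ?d H"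
      using kT unfolding pH of_nat_mult of_nat_power of_nat_Suc of_nat_numeral
      by (intro mult_mono divide_right_mono) auto
    have nn: "0 \<le> ?a H" "0 \<le> ?b H" "0 \<le> ?d H" by auto
    define a' b' d' where "a' = real k * (1 / (4 * 2 ^ H))" "b' = real (2 * k + 1) / 2 ^ K"
      "d' = real k * (real (Suc H) * (real (k * H) / real (2 ^ H)))"
    have sum: "a' + b' + d' < p" "0 \<le> a'" "0 \<le> b'" "0 \<le> d'"
      using H0[OF H] a b d unfolding a'_b'_d'_def by (linarith, auto)
    \<comment> \<open>Bernoulli's inequality makes the \<open>k\<close>-th power linear in
      \<open>k\<close>.\<close>
    have "1 + real k * (- (1 / (4 * 2 ^ H))) \<le> (1 + - (1 / (4 * 2 ^ H))) ^ k"
    proof (rule Bernoulli_inequality)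
      have "1 \<le> (2::real) ^ H" by simp
      then have "1 \<le> 4 * (2::real) ^ H" by linarith
      then show "- 1 \<le> - (1 / (4 * 2 ^ H :: real))" by simp
    qed
    then have q: "1 - a' \<le> (1 - 1 / real (4 * 2 ^ H)) ^ k"
      by (simp add: a'_b'_d'_def)
    \<comment> \<open>A product of factors \<open>1 - t\<close> is at least 1 minus the sum of the
      \<open>t\<close>, so it suffices that the losses sum to less than \<open>p\<close>.\<close>
    have "1 - p < 1 - a' - b' - d'" using sum by simp
    also have "\<dots> \<le> (1 - a') * (1 - b') * (1 - d')"
    proof -
      have "1 - a' - b' \<le> (1 - a') * (1 - b')" using sum by (simp add: algebra_simps)
      then have "(1 - a' - b') * (1 - d') \<le> (1 - a') * (1 - b') * (1 - d')"
        using sum assms by (intro mult_right_mono) auto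
      moreover have "1 - a' - b' - d' \<le> (1 - a' - b') * (1 - d')"
      proof -
        have "(1 - a' - b') * (1 - d') = 1 - a' - b' - d' + (a' * d' + b' * d')"
          by (simp add: algebra_simps)
        moreover have "0 \<le> a' * d' + b' * d'" using sum by simp
        ultimately show ?thesis by linarith
      qed
      ultimately show ?thesis by linarith
    qed
    also have "\<dots> \<le> (1 - 1 / real (4 * 2 ^ H)) ^ k * (1 - b') * (1 - d')"
      using q sum assms by (intro mult_right_mono) auto
    finally have "1 - p < (1 - 1 / real (4 * 2 ^ H)) ^ k * (1 - b') * (1 - d')" .
    moreover have "2 * k + 1 \<le> 2 ^ K"
    proof -
      have "b' < 1" using sum assms by simp
      then have "real (2 * k + 1) < real (2 ^ K)" by (simp add: a'_b'_d'_def)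
      then show ?thesis by (simp only: of_nat_less_iff)
    qed
    ultimately show "2 * k + 1 \<le> 2 ^ K \<and>
      1 - p < (1 - 1 / real (4 * 2 ^ H)) ^ k * (1 - real (2 * k + 1) / 2 ^ K) *
        (1 - real k * (real (Suc H) * (real (k * H) / real (2 ^ H))))"
      by (simp add: a'_b'_d'_def)
  qed
qed

section \<open>Choice of the witnesses\<close>

theorem theorem1:
  fixes p :: real
  assumes "0 < p" and "p < 1"
  shows "\<exists>(c::real) (C::real) (H0::nat). 0 < c \<and> 0 < C \<and>
    (\<forall>H\<ge>H0. \<exists>(X :: nat \<Rightarrow> nat set) (Pol :: (nat \<Rightarrow> nat) set)
        (\<M> :: (nat, nat) mdp set) (\<mu> :: nat \<Rightarrow> nat pmf).
      layered H X \<and>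
      real (card (\<Union>h\<in>{1..H}. X h)) \<le> 2 powr (C * real H) \<and>
      Pol \<subseteq> ((\<Union>h\<in>{1..H}. X h) \<rightarrow>\<^sub>E {0, 1}) \<and> card Pol = 2 ^ H \<and>
      (\<forall>M\<in>\<M>. is_mdp M \<and> layer M = X \<and> actions M = {0, 1} \<and> horizon M = H \<and> is_reset \<mu> M \<and>
         realizable Pol M \<and> C_all \<mu> M \<le> 4) \<and>
      (\<forall>alg. proper_algorithm H {0, 1} Pol alg \<and>
             (\<forall>M\<in>\<M>. prob_returns M \<mu> alg (eps_optimal Pol M (1/8)) \<ge> p) \<longrightarrow>
         (\<exists>M\<in>\<M>. prob_samples_at_least M \<mu> alg (2 powr (c * real H)) > 0)))"
proof -
  obtain H0 where H0: "\<And>H K k. H0 \<le> H \<Longrightarrow> K = H div 2 \<Longrightarrow> k = nat \<lceil>2 powr (1 / 8 * real H)\<rceil> \<Longrightarrow>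
      2 * k + 1 \<le> 2 ^ K \<and>
      1 - p < (1 - 1 / real (4 * 2 ^ H)) ^ k * (1 - real (2 * k + 1) / 2 ^ K) *
        (1 - real k * (real (Suc H) * (real (k * H) / real (2 ^ H))))"
    using hard_parameters[OF assms] by blast
  show ?thesis
  \<comment> \<open>The rate 1/8 is the one of \<open>hard_parameters\<close>, 5 comes from counting
    states, and \<open>4 \<le> H\<close> ensures \<open>2 \<le> K\<close>.\<close>
  proof (rule exI[of _ "1 / 8"], rule exI[of _ 5], rule exI[of _ "max H0 4"], intro conjI allI impI)
    fix H assume "max H0 4 \<le> H"
    then have H: "H0 \<le> H" "4 \<le> H" by auto
    define K k where "K = H div 2" and "k = nat \<lceil>2 powr (1 / 8 * real H)\<rceil>"
    \<comment> \<open>With \<open>m\<close> and \<open>n\<close> equal to \<open>2 ^ H\<close>, the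
      losses of order \<open>k / S\<close> and \<open>k ^ 2 / n\<close> are exponentially small for
      \<open>k\<close> near \<open>2 powr (H / 8)\<close>.\<close>
    interpret hard_family H K "2 ^ H" "2 ^ H"
      using H by unfold_locales (auto simp: K_def)
    let ?Pol = "pol ` Pow {1..H}" and ?\<mu> = "\<lambda>h. pmf_of_set (X h)"
    let ?\<M> = "{mdp_of \<theta> \<omega> |\<theta> \<omega>. \<theta> \<in> Pow {1..H}}"
    show "\<exists>(X :: nat \<Rightarrow> nat set) (Pol :: (nat \<Rightarrow> nat) set)
        (\<M> :: (nat, nat) mdp set) (\<mu> :: nat \<Rightarrow> nat pmf).
      layered H X \<and>
      real (card (\<Union>h\<in>{1..H}. X h)) \<le> 2 powr (5 * real H) \<and>
      Pol \<subseteq> ((\<Union>h\<in>{1..H}. X h) \<rightarrow>\<^sub>E {0, 1}) \<and> card Pol = 2 ^ H \<and>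
      (\<forall>M\<in>\<M>. is_mdp M \<and> layer M = X \<and> actions M = {0, 1} \<and> horizon M = H \<and> is_reset \<mu> M \<and>
         realizable Pol M \<and> C_all \<mu> M \<le> 4) \<and>
      (\<forall>alg. proper_algorithm H {0, 1} Pol alg \<and>
             (\<forall>M\<in>\<M>. prob_returns M \<mu> alg (eps_optimal Pol M (1/8)) \<ge> p) \<longrightarrow>
         (\<exists>M\<in>\<M>. prob_samples_at_least M \<mu> alg (2 powr (1 / 8 * real H)) > 0))"
    proof (rule exI[of _ X], rule exI[of _ ?Pol], rule exI[of _ ?\<M>], rule exI[of _ ?\<mu>],
        intro conjI ballI allI impI)
      show "real (card (\<Union>h\<in>{1..H}. X h)) \<le> 2 powr (5 * real H)"
      proof -
        have "card (\<Union>h\<in>{1..H}. X h) \<le> (\<Sum>h\<in>{1..H}. card (X h))"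
          by (rule card_UN_le) simp
        also have "\<dots> = H * (2 ^ H * (4 * 2 ^ H))" by (simp add: card_X S_def)
        \<comment> \<open>A crude bound, with \<open>2 ^ H\<close> in place of \<open>H\<close> and
          \<open>2 ^ (2 * H)\<close> in place of 4.\<close>
        also have "\<dots> \<le> 2 ^ H * (2 ^ H * (2 ^ (2 * H) * 2 ^ H))"
        proof (intro mult_le_mono le_refl)
          show "H \<le> 2 ^ H" by simp
          have "(2::nat) ^ 2 \<le> 2 ^ (2 * H)" using H by (intro power_increasing) auto
          then show "4 \<le> (2::nat) ^ (2 * H)" by simp
        qed
        also have "\<dots> = 2 ^ (5 * H)" by (simp flip: power_add)
        finally have "real (card (\<Union>h\<in>{1..H}. X h)) \<le> real (2 ^ (5 * H))" by (rule of_nat_mono)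
        also have "\<dots> = 2 powr (5 * real H)" by (simp flip: powr_realpow)
        finally show ?thesis .
      qed
      show "?Pol \<subseteq> (\<Union>h\<in>{1..H}. X h) \<rightarrow>\<^sub>E {0, 1}"
        using pol_in_policies unfolding policies_def state_space_def mdp_of_simps
        by (auto simp only: image_subset_iff)
      show "card ?Pol = 2 ^ H"
        by (subst card_image[OF inj_on_pol]) (simp add: card_Pow)
    next
      fix alg assume alg: "proper_algorithm H {0, 1} ?Pol alg \<and>
        (\<forall>M\<in>?\<M>. p \<le> prob_returns M ?\<mu> alg (eps_optimal ?Pol M (1 / 8)))"
      have "\<exists>\<theta>\<in>Pow {1..H}. \<exists>\<omega>.
        0 < prob_samples_at_least (mdp_of \<theta> \<omega>) ?\<mu> alg (2 powr (1 / 8 * real H))"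
      proof (rule many_samples[where k = k and p = p])
        show "2 * K \<le> H" by (simp add: K_def)
        show "2 powr (1 / 8 * real H) \<le> real k"
          unfolding k_def using real_nat_ceiling_ge by blast
        show "2 * k + 1 \<le> 2 ^ K" using H0[OF H(1) K_def k_def] by blast
        show "1 - p < (1 - 1 / real S) ^ k * (1 - real (2 * k + 1) / 2 ^ K) *
            (1 - real k * (real (Suc H) * (real (k * H) / real (2 ^ H))))"
          using H0[OF H(1) K_def k_def] unfolding S_def by blast
      qed (use alg in blast)+
      then show "\<exists>M\<in>?\<M>. 0 < prob_samples_at_least M ?\<mu> alg (2 powr (1 / 8 * real H))"
        by blast
    next
      fix M assume "M \<in> ?\<M>"
      then obtain \<theta> \<omega> where M: "M = mdp_of \<theta> \<omega>" "\<theta> \<in> Pow {1..H}" by blast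
      show "is_mdp M" "layer M = X" "actions M = {0, 1}" "horizon M = H" "realizable ?Pol M"
        "C_all ?\<mu> M \<le> 4" "is_reset ?\<mu> M"
        using M by (simp_all add: is_mdp_mdp_of realizable_mdp_of C_all_le is_reset_def)
    qed (rule layered_X)
  qed simp_all
qed

end
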